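(* Let $(\mathfrak m,V,\omega,B_\mu)$ be a real special symplectic representation (i.e. over $k=\mathbb R$) such that $Q\not\equiv0$. Then $(\mathcal F,\mathcal G)$ is a one-dimensional abstract noncommutative, completely integrable system on the symplectic manifold $(\mathcal O,\omega)$, where $\mathcal O=\{A\in V:Q(A)\neq0\}$, $\mathcal G$ is the foliation of $\mathcal O$ by orbits of the group $M$ obtained by exponentiating $\mathfrak m$, and $\mathcal F$ is the foliation of $\mathcal O$ defined by the fibres of $\mu$.
   Context: $V$ is a finite-dimensional real vector space. A special symplectic representation (SSR) $(\mathfrak m,V,\omega,B_\mu)$ over $k$ is a faithful representation of a Lie algebra $\mathfrak m$ over $k$ on a symplectic vector space $(V,\omega)$ ($\omega$ a nondegenerate alternating bilinear form), together with an $\mathfrak m$-equivariant symmetric bilinear map $B_\mu:V\times V\to\mathfrak m$ (equivariance: $[m,B_\mu(A,B)]=B_\mu(m\cdot A,B)+B_\mu(A,m\cdot B)$), such that for all $m\in\mathfrak m$ and $A,B,C\in V$: $$\omega(m\cdot A,B)+\omega(A,m\cdot B)=0,$$ $$2B_\mu(A,B)\cdot C-2B_\mu(A,C)\cdot B=2\omega(B,C)A-\omega(A,B)C+\omega(A,C)B.$$ Covariants: $\mu(A)=B_\mu(A,A)\in\mathfrak m$, $\Psi(A)=\mu(A)\cdot A\in V$, $Q(A)=\frac32\,\omega(A,\Psi(A))\in\mathbb R$. The distribution tangent to $\mathcal F$ is $A\mapsto\mathrm{Ker}\,d\mu_A$, where $d\mu_A(B)=2B_\mu(A,B)$; the distribution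 tangent to $\mathcal G$ is $A\mapsto\mathfrak m\cdot A=\{m\cdot A:m\in\mathfrak m\}$. A pair of foliations $(\mathcal F,\mathcal G)$ on a symplectic manifold $(\mathcal O,\omega)$ is a one-dimensional abstract noncommutative, completely integrable system if: (1) $\mathcal F$ is of rank $1$ and $\mathcal G$ is of corank $1$; (2) $\mathcal F\subseteq\mathcal G$; (3) $\omega(\mathcal F,\mathcal G)=0$ (conditions (2) and (3) being conditions on the tangent distributions at every point of $\mathcal O$). *)

theory Defs
  imports "HOL-Analysis.Analysis"
begin

definition symplectic_form :: "('v::real_vector \<Rightarrow> 'v \<Rightarrow> real) \<Rightarrow> bool" where
  "symplectic_form \<omega> \<longleftrightarrow> bilinear \<omega> \<and> (\<forall>v. \<omega> v v = 0) \<and> (\<forall>u. (\<forall>v. \<omega> u v = 0) \<longrightarrow> u = 0)"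

definition lie_bracket :: "('m::real_vector \<Rightarrow> 'm \<Rightarrow> 'm) \<Rightarrow> bool" where
  "lie_bracket br \<longleftrightarrow> bilinear br \<and> (\<forall>x. br x x = 0) \<and>
     (\<forall>x y z. br x (br y z) + br y (br z x) + br z (br x y) = 0)"

definition faithful_representation ::
    "('m::real_vector \<Rightarrow> 'm \<Rightarrow> 'm) \<Rightarrow> ('m \<Rightarrow> 'v::real_vector \<Rightarrow> 'v) \<Rightarrow> bool" where
  "faithful_representation br act \<longleftrightarrow> bilinear act \<and>
     (\<forall>x y v. act (br x y) v = act x (act y v) - act y (act x v)) \<and> inj act"

definition special_symplectic_rep ::
    "('m::real_vector \<Rightarrow> 'm \<Rightarrow> 'm) \<Rightarrow> ('m \<Rightarrow> 'v::real_vector \<Rightarrow> 'v) \<Rightarrow>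
     ('v \<Rightarrow> 'v \<Rightarrow> real) \<Rightarrow> ('v \<Rightarrow> 'v \<Rightarrow> 'm) \<Rightarrow> bool" where
  "special_symplectic_rep br act \<omega> B \<longleftrightarrow>
     lie_bracket br \<and> faithful_representation br act \<and> symplectic_form \<omega> \<and>
     bilinear B \<and> (\<forall>u v. B u v = B v u) \<and>
     (\<forall>m u v. br m (B u v) = B (act m u) v + B u (act m v)) \<and>
     (\<forall>m u v. \<omega> (act m u) v + \<omega> u (act m v) = 0) \<and>
     (\<forall>u v w. 2 *\<^sub>R act (B u v) w - 2 *\<^sub>R act (B u w) v =
        (2 * \<omega> v w) *\<^sub>R u - \<omega> u v *\<^sub>R w + \<omega> u w *\<^sub>R v)"

definition ssr_mu :: "('v \<Rightarrow> 'v \<Rightarrow> 'm) \<Rightarrow> 'v \<Rightarrow> 'm" where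
  "ssr_mu B A = B A A"

definition ssr_Psi :: "('m \<Rightarrow> 'v \<Rightarrow> 'v) \<Rightarrow> ('v \<Rightarrow> 'v \<Rightarrow> 'm) \<Rightarrow> 'v \<Rightarrow> 'v" where
  "ssr_Psi act B A = act (ssr_mu B A) A"

definition ssr_Q ::
    "('m \<Rightarrow> 'v \<Rightarrow> 'v) \<Rightarrow> ('v \<Rightarrow> 'v \<Rightarrow> real) \<Rightarrow> ('v \<Rightarrow> 'v \<Rightarrow> 'm) \<Rightarrow> 'v \<Rightarrow> real" where
  "ssr_Q act \<omega> B A = 3 / 2 * \<omega> A (ssr_Psi act B A)"

text \<open>The derivative of \<open>\<mu>\<close> at \<open>A\<close>; it is written out because \<open>'m\<close> carries no topology.\<close>

definition ssr_dmu :: "('v \<Rightarrow> 'v \<Rightarrow> 'm::real_vector) \<Rightarrow> 'v \<Rightarrow> 'v \<Rightarrow> 'm" where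
  "ssr_dmu B A v = 2 *\<^sub>R B A v"

text \<open>Differentiability of class \<open>C\<^sup>k\<close> and \<open>C\<^sup>\<infinity>\<close>, intended for open \<open>S\<close> in a
  finite-dimensional space: all iterated directional derivatives up to order \<open>k\<close> exist
  and are continuous.\<close>

primrec Ck_on ::
    "nat \<Rightarrow> ('a::real_normed_vector \<Rightarrow> 'b::real_normed_vector) \<Rightarrow> 'a set \<Rightarrow> bool" where
  "Ck_on 0 f S \<longleftrightarrow> continuous_on S f"
| "Ck_on (Suc k) f S \<longleftrightarrow> (\<forall>x\<in>S. f differentiable (at x)) \<and>
     (\<forall>v. Ck_on k (\<lambda>x. frechet_derivative f (at x) v) S)"

definition smooth_on :: "('a::real_normed_vector \<Rightarrow> 'b::real_normed_vector) \<Rightarrow> 'a set \<Rightarrow> bool" where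
  "smooth_on f S \<longleftrightarrow> (\<forall>k. Ck_on k f S)"

definition diffeomorphism ::
    "('a::real_normed_vector \<Rightarrow> 'b::real_normed_vector) \<Rightarrow> 'a set \<Rightarrow> 'b set \<Rightarrow> bool" where
  "diffeomorphism \<phi> U W \<longleftrightarrow> open U \<and> open W \<and> bij_betw \<phi> U W \<and>
     smooth_on \<phi> U \<and> smooth_on (inv_into U \<phi>) W"

text \<open>Symplectic manifolds, for manifolds that are open subsets of a finite-dimensional vector
  space, so that each tangent space is the vector space itself.  The last clause says that the
  exterior derivative of the 2-form \<open>\<Omega>\<close> vanishes, evaluated on constant vector fields.\<close>

definition symplectic_manifold :: "'v::euclidean_space set \<Rightarrow> ('v \<Rightarrow> 'v \<Rightarrow> 'v \<Rightarrow> real) \<Rightarrow> bool" where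
  "symplectic_manifold S \<Omega> \<longleftrightarrow> open S \<and> (\<forall>A\<in>S. symplectic_form (\<Omega> A)) \<and>
     (\<forall>u v. smooth_on (\<lambda>A. \<Omega> A u v) S) \<and>
     (\<forall>A\<in>S. \<forall>u v w. frechet_derivative (\<lambda>A. \<Omega> A v w) (at A) u +
                     frechet_derivative (\<lambda>A. \<Omega> A w u) (at A) v +
                     frechet_derivative (\<lambda>A. \<Omega> A u v) (at A) w = 0)"

text \<open>A flat chart for a family of leaves \<open>L\<close> with tangent distribution \<open>T\<close>: a chart onto a
  coordinate box in which every leaf is a countable union of \<open>r\<close>-dimensional coordinate slices
  (those on which the coordinates outside \<open>I\<close> are constant) and \<open>T\<close> consists of the
  tangent spaces of the slices.\<close>

definition flat_chart ::
    "nat \<Rightarrow> 'v::euclidean_space set set \<Rightarrow> ('v \<Rightarrow> 'v set) \<Rightarrow> 'v set \<Rightarrow> ('v \<Rightarrow> 'v) \<Rightarrow> bool" where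
  "flat_chart r L T U \<phi> \<longleftrightarrow> (\<exists>a b I. I \<subseteq> Basis \<and> card I = r \<and> diffeomorphism \<phi> U (box a b) \<and>
     (\<forall>l\<in>L. \<exists>K. countable K \<and>
        \<phi> ` (l \<inter> U) = (\<Union>c\<in>K. {x \<in> box a b. \<forall>i\<in>Basis - I. x \<bullet> i = c \<bullet> i})) \<and>
     (\<forall>A\<in>U. T A = {v. \<forall>i\<in>Basis - I. frechet_derivative \<phi> (at A) v \<bullet> i = 0}))"

text \<open>The family \<open>L\<close> of leaves is a smooth foliation of rank \<open>r\<close> of the open set \<open>S\<close>, and
  \<open>T\<close> is its tangent distribution.  Flat charts make each leaf an immersed submanifold.  Leaves
  have to be connected in their own (possibly finer) topology; since a leaf meets a flat chart in
  only countably many slices, every path of the ambient space that stays in a leaf is continuous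
  for the leaf topology, so this is path-connectedness as a subset.\<close>

definition foliation ::
    "'v::euclidean_space set \<Rightarrow> nat \<Rightarrow> 'v set set \<Rightarrow> ('v \<Rightarrow> 'v set) \<Rightarrow> bool" where
  "foliation S r L T \<longleftrightarrow> open S \<and> partition_on S L \<and> (\<forall>l\<in>L. path_connected l) \<and>
     (\<forall>A\<in>S. \<exists>U \<phi>. A \<in> U \<and> U \<subseteq> S \<and> flat_chart r L T U \<phi>)"

text \<open>One-dimensional abstract noncommutative, completely integrable systems; a foliation is
  given by its leaves and its tangent distribution.\<close>

definition nc_integrable_system_1 ::
    "'v::euclidean_space set \<Rightarrow> ('v \<Rightarrow> 'v \<Rightarrow> 'v \<Rightarrow> real) \<Rightarrow>
     'v set set \<Rightarrow> ('v \<Rightarrow> 'v set) \<Rightarrow> 'v set set \<Rightarrow> ('v \<Rightarrow> 'v set) \<Rightarrow> bool" where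
  "nc_integrable_system_1 S \<Omega> LF TF LG TG \<longleftrightarrow>
     symplectic_manifold S \<Omega> \<and>
     foliation S 1 LF TF \<and> foliation S (DIM('v) - 1) LG TG \<and>
     (\<forall>A\<in>S. TF A \<subseteq> TG A) \<and>
     (\<forall>A\<in>S. \<forall>u\<in>TF A. \<forall>v\<in>TG A. \<Omega> A u v = 0)"

definition exp_endo :: "('v::euclidean_space \<Rightarrow> 'v) \<Rightarrow> 'v \<Rightarrow> 'v" where
  "exp_endo f v = (\<Sum>n. (1 / fact n) *\<^sub>R (f ^^ n) v)"

text \<open>The group of linear transformations generated by the exponentials of the Lie algebra;
  inverses need no clause because the inverse of the exponential of \<open>m\<close> is that of \<open>- m\<close>.\<close>

inductive_set exp_group :: "('m \<Rightarrow> 'v::euclidean_space \<Rightarrow> 'v) \<Rightarrow> ('v \<Rightarrow> 'v) set"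
  for act :: "'m \<Rightarrow> 'v \<Rightarrow> 'v" where
  exp_group_id: "id \<in> exp_group act"
| exp_group_exp: "g \<in> exp_group act \<Longrightarrow> exp_endo (act m) \<circ> g \<in> exp_group act"

definition ssr_domain ::
    "('m \<Rightarrow> 'v \<Rightarrow> 'v) \<Rightarrow> ('v \<Rightarrow> 'v \<Rightarrow> real) \<Rightarrow> ('v \<Rightarrow> 'v \<Rightarrow> 'm) \<Rightarrow> 'v set" where
  "ssr_domain act \<omega> B = {A. ssr_Q act \<omega> B A \<noteq> 0}"

text \<open>The leaves of the foliation defined by the fibres of \<open>\<mu>\<close> are the connected components of
  the fibres (which need not be connected: \<open>\<mu>\<close> is even).\<close>

definition F_leaves ::
    "('m \<Rightarrow> 'v::euclidean_space \<Rightarrow> 'v) \<Rightarrow> ('v \<Rightarrow> 'v \<Rightarrow> real) \<Rightarrow> ('v \<Rightarrow> 'v \<Rightarrow> 'm) \<Rightarrow> 'v set set" where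
  "F_leaves act \<omega> B = (\<Union>m. components {A \<in> ssr_domain act \<omega> B. ssr_mu B A = m})"

definition F_tangent :: "('v \<Rightarrow> 'v \<Rightarrow> 'm::real_vector) \<Rightarrow> 'v \<Rightarrow> 'v set" where
  "F_tangent B A = {v. ssr_dmu B A v = 0}"

definition G_leaves ::
    "('m \<Rightarrow> 'v::euclidean_space \<Rightarrow> 'v) \<Rightarrow> ('v \<Rightarrow> 'v \<Rightarrow> real) \<Rightarrow> ('v \<Rightarrow> 'v \<Rightarrow> 'm) \<Rightarrow> 'v set set" where
  "G_leaves act \<omega> B = (\<lambda>A. (\<lambda>g. g A) ` exp_group act) ` ssr_domain act \<omega> B"

definition G_tangent :: "('m \<Rightarrow> 'v \<Rightarrow> 'v) \<Rightarrow> 'v \<Rightarrow> 'v set" where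
  "G_tangent act A = range (\<lambda>m. act m A)"

end

theory Submission
  imports Defs
begin

text \<open>Everything follows from the algebra of a single point \<open>A\<close> with \<open>Q A \<noteq> 0\<close>. Equivariance of \<open>B\<close> gives
\<open>B A (\<Psi> A) = 0\<close>, \<open>\<mu>(A) \<cdot> \<Psi> A = Q A \<cdot> A\<close> and \<open>\<mu>(\<Psi> A) = - Q A \<cdot> \<mu>(A)\<close>, and the defining identity of the
representation shows that the kernel of the derivative of \<open>\<mu>\<close> is exactly the line through \<open>\<Psi> A\<close>
(\<open>kernel_dmu\<close>). By the symmetry \<open>\<omega> (B x y \<cdot> A) u = \<omega> (B A u \<cdot> x) y\<close> and faithfulness, a vector that is
\<open>\<omega>\<close>-orthogonal to all \<open>m \<cdot> A\<close> lies in that kernel; hence the space of all \<open>m \<cdot> A\<close> is the \<open>\<omega>\<close>-orthogonal complement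
of \<open>\<Psi> A\<close> (\<open>orbit_tangent\<close>), which is also the kernel of the derivative of \<open>Q\<close>. Thus the two
distributions are a line and its symplectic complement, and the inclusion and the orthogonality
required of an integrable system are immediate.

What remains is to see that both families of leaves really are foliations, and for this explicit
charts take the place of the Frobenius theorem. For the orbits, \<open>Q\<close> is invariant and
homogeneous of degree four, so \<open>Q\<close> together with affine coordinates on projective space
is a chart whose slices are pieces of level sets of \<open>Q\<close>; orbits are open in these level sets by
an open mapping argument, so a slice, being connected, lies in one orbit. For the fibres of \<open>\<mu>\<close>, the
vector field \<open>\<Psi>\<close> preserves the plane spanned by \<open>A\<close> and \<open>\<Psi> A\<close>, where its integral curves lie
on conics of points \<open>a A + b \<Psi> A\<close> with \<open>a\<^sup>2 - b\<^sup>2 Q A = 1\<close>. Flowing each point along its conic to a fixed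
hyperplane is therefore an algebraic operation, and straightens the fibres. Distinct points
of the hyperplane near the base point have distinct values of \<open>\<mu>\<close>: since
\<open>\<mu>(u) - \<mu>(v) = B (u + v) (u - v)\<close>, equality of values makes \<open>u - v\<close> a multiple of \<open>\<Psi> (u + v)\<close>, which is
transverse to the hyperplane.

In both cases every leaf meets the chart in at most one slice, and \<open>foliation_if_slice_charts\<close>
reduces the definition of a foliation to this situation.\<close>

section \<open>Smooth maps\<close>

text \<open>The inverse of a diffeomorphism is only determined on its domain, and the derivatives below are
only computed on the set of interest; replacing a function by another one that agrees with it
on an open set makes both harmless.\<close>

lemma Ck_on_cong:
  assumes "open S" "\<And>x. x \<in> S \<Longrightarrow> f x = g x" "Ck_on k f S"
  shows "Ck_on k g S"
  using assms(2,3)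
proof (induction k arbitrary: f g)
  case 0
  then show ?case by (simp cong: continuous_on_cong)
next
  case (Suc k)
  have D: "(g has_derivative frechet_derivative f (at x)) (at x)" if "x \<in> S" for x
  proof (rule has_derivative_transform_within_open[OF _ \<open>open S\<close> that])
    show "(f has_derivative frechet_derivative f (at x)) (at x)"
      using Suc.prems(2) that frechet_derivative_works by auto
  qed (use Suc.prems in auto)
  have "Ck_on k (\<lambda>x. frechet_derivative g (at x) v) S" for v
  proof (rule Suc.IH)
    show "Ck_on k (\<lambda>x. frechet_derivative f (at x) v) S" using Suc.prems(2) by simp
  qed (use frechet_derivative_at[OF D] in simp)
  then show ?case using D by (auto simp: differentiable_def)
qed

lemma Ck_on_SucI:
  assumes "open S" "\<And>x. x \<in> S \<Longrightarrow> (f has_derivative f' x) (at x)"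
    and "\<And>v. Ck_on k (\<lambda>x. f' x v) S"
  shows "Ck_on (Suc k) f S"
proof -
  have "Ck_on k (\<lambda>x. frechet_derivative f (at x) v) S" for v
    by (rule Ck_on_cong[OF assms(1) _ assms(3)]) (simp add: frechet_derivative_at[OF assms(2), symmetric])
  then show ?thesis using assms(2) by (auto simp: differentiable_def)
qed

lemma Ck_on_Suc_derivative:
  assumes "Ck_on (Suc k) f S" "x \<in> S"
  shows "(f has_derivative frechet_derivative f (at x)) (at x)"
  using assms frechet_derivative_works by auto

lemma Ck_on_SucD: "Ck_on (Suc k) f S \<Longrightarrow> Ck_on k f S"
proof (induction k arbitrary: f)
  case 0
  then show ?case
    by (auto intro!: continuous_at_imp_continuous_on differentiable_imp_continuous_within)
next
  case (Suc k)
  then show ?case by auto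
qed

lemma Ck_on_add:
  assumes "open S" "Ck_on k f S" "Ck_on k g S"
  shows "Ck_on k (\<lambda>x. f x + g x) S"
  using assms(2,3)
proof (induction k arbitrary: f g)
  case 0
  then show ?case by (auto intro: continuous_on_add)
next
  case (Suc k)
  show ?case
  proof (rule Ck_on_SucI[OF assms(1)])
    show "((\<lambda>x. f x + g x) has_derivative
        (\<lambda>v. frechet_derivative f (at x) v + frechet_derivative g (at x) v)) (at x)" if "x \<in> S" for x
      using Suc.prems that by (intro has_derivative_add Ck_on_Suc_derivative)
  qed (use Suc in auto)
qed

lemma Ck_on_linear:
  assumes "open S" "bounded_linear h" "Ck_on k f S"
  shows "Ck_on k (\<lambda>x. h (f x)) S"
  using assms(3)
proof (induction k arbitrary: f)
  case 0
  then show ?case using assms(2) by (auto intro: bounded_linear.continuous_on)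
next
  case (Suc k)
  show ?case
  proof (rule Ck_on_SucI[OF assms(1)])
    show "((\<lambda>x. h (f x)) has_derivative (\<lambda>v. h (frechet_derivative f (at x) v))) (at x)"
      if "x \<in> S" for x
      using Suc.prems that
      by (intro bounded_linear.has_derivative[OF assms(2)] Ck_on_Suc_derivative)
  qed (use Suc in auto)
qed

text \<open>By the product rule the derivative is a sum of two terms of the same shape, with one factor
differentiated; this is why the induction is on both factors at once and why the undifferentiated
factor has to be weakened by one order.\<close>

lemma Ck_on_bilinear:
  assumes "open S" "bounded_bilinear p" "Ck_on k f S" "Ck_on k g S"
  shows "Ck_on k (\<lambda>x. p (f x) (g x)) S"
  using assms(3,4)
proof (induction k arbitrary: f g)
  case 0
  then show ?case using assms(2) by (auto intro: bounded_bilinear.continuous_on)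
next
  case (Suc k)
  show ?case
  proof (rule Ck_on_SucI[OF assms(1)])
    show "((\<lambda>x. p (f x) (g x)) has_derivative
        (\<lambda>v. p (f x) (frechet_derivative g (at x) v) + p (frechet_derivative f (at x) v) (g x))) (at x)"
      if "x \<in> S" for x
      using Suc.prems that by (intro bounded_bilinear.FDERIV[OF assms(2)] Ck_on_Suc_derivative)
    show "Ck_on k (\<lambda>x. p (f x) (frechet_derivative g (at x) v) +
        p (frechet_derivative f (at x) v) (g x)) S" for v
      using Suc.prems(1,2)[THEN Ck_on_SucD] Suc.prems
      by (intro Ck_on_add[OF assms(1)] Suc.IH) auto
  qed
qed

lemma Ck_on_const: "Ck_on k (\<lambda>x. c) S"
  by (induction k arbitrary: c) auto

lemma Ck_on_ident:
  assumes "open S"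
  shows "Ck_on k (\<lambda>x. x) S"
  by (cases k) (auto simp: Ck_on_const)

lemma Ck_on_inverse:
  fixes f :: "'a::real_normed_vector \<Rightarrow> real"
  assumes "open S" "\<And>x. x \<in> S \<Longrightarrow> f x \<noteq> 0" "Ck_on k f S"
  shows "Ck_on k (\<lambda>x. inverse (f x)) S"
  using assms(3)
proof (induction k)
  case 0
  then show ?case using assms(2) by (auto intro: continuous_on_inverse)
next
  case (Suc k)
  show ?case
  proof (rule Ck_on_SucI[OF assms(1)])
    show "((\<lambda>x. inverse (f x)) has_derivative
        (\<lambda>v. - (inverse (f x) * frechet_derivative f (at x) v * inverse (f x)))) (at x)"
      if "x \<in> S" for x
      using Suc.prems that assms(2) by (intro Deriv.has_derivative_inverse Ck_on_Suc_derivative) auto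
    show "Ck_on k (\<lambda>x. - (inverse (f x) * frechet_derivative f (at x) v * inverse (f x))) S" for v
      using Suc.prems Suc.IH[OF Ck_on_SucD[OF Suc.prems]]
      by (intro Ck_on_linear[OF assms(1) bounded_linear_minus[OF bounded_linear_ident]]
          Ck_on_bilinear[OF assms(1) bounded_bilinear_mult]) auto
  qed
qed

text \<open>The derivative of \<open>f powr a\<close> is written as \<open>a (f powr a) (f' / f)\<close> so that the same exponent
recurs and the induction on the order closes.\<close>

lemma Ck_on_powr:
  fixes f :: "'a::real_normed_vector \<Rightarrow> real"
  assumes "open S" "\<And>x. x \<in> S \<Longrightarrow> f x > 0" "Ck_on k f S"
  shows "Ck_on k (\<lambda>x. f x powr a) S"
  using assms(3)
proof (induction k)
  case 0
  then show ?case using assms(2) by (force intro!: continuous_on_powr continuous_on_const)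
next
  case (Suc k)
  show ?case
  proof (rule Ck_on_SucI[OF assms(1)])
    show "((\<lambda>x. f x powr a) has_derivative
        (\<lambda>v. a * ((f x powr a) * (frechet_derivative f (at x) v * inverse (f x))))) (at x)"
      if "x \<in> S" for x
      by (rule has_derivative_eq_rhs[OF has_derivative_powr[OF Ck_on_Suc_derivative[OF Suc.prems that]
          has_derivative_const]])
        (use that assms(2) in \<open>auto simp: field_simps\<close>)
    show "Ck_on k (\<lambda>x. a * ((f x powr a) * (frechet_derivative f (at x) v * inverse (f x)))) S" for v
      using Suc.prems Suc.IH[OF Ck_on_SucD[OF Suc.prems]] Ck_on_SucD[OF Suc.prems] assms(1,2)
      by (intro Ck_on_bilinear[OF assms(1) bounded_bilinear_mult] Ck_on_const Ck_on_inverse) force+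
  qed
qed

lemma smooth_on_const: "smooth_on (\<lambda>x. c) S"
  by (simp add: smooth_on_def Ck_on_const)

lemma smooth_on_ident: "open S \<Longrightarrow> smooth_on (\<lambda>x. x) S"
  by (simp add: smooth_on_def Ck_on_ident)

lemma smooth_on_add: "open S \<Longrightarrow> smooth_on f S \<Longrightarrow> smooth_on g S \<Longrightarrow> smooth_on (\<lambda>x. f x + g x) S"
  by (simp add: smooth_on_def Ck_on_add)

lemma smooth_on_linear:
  "bounded_linear h \<Longrightarrow> open S \<Longrightarrow> smooth_on f S \<Longrightarrow> smooth_on (\<lambda>x. h (f x)) S"
  by (simp add: smooth_on_def Ck_on_linear)

lemma smooth_on_bilinear:
  "bounded_bilinear p \<Longrightarrow> open S \<Longrightarrow> smooth_on f S \<Longrightarrow> smooth_on g S \<Longrightarrow>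
    smooth_on (\<lambda>x. p (f x) (g x)) S"
  by (simp add: smooth_on_def Ck_on_bilinear)

lemma smooth_on_diff:
  "open S \<Longrightarrow> smooth_on f S \<Longrightarrow> smooth_on g S \<Longrightarrow> smooth_on (\<lambda>x. f x - g x) S"
  using smooth_on_add[of S f "\<lambda>x. - g x"]
    smooth_on_linear[OF bounded_linear_minus[OF bounded_linear_ident]] by auto

lemma smooth_on_inverse:
  fixes f :: "'a::real_normed_vector \<Rightarrow> real"
  shows "open S \<Longrightarrow> (\<And>x. x \<in> S \<Longrightarrow> f x \<noteq> 0) \<Longrightarrow> smooth_on f S \<Longrightarrow> smooth_on (\<lambda>x. inverse (f x)) S"
  by (simp add: smooth_on_def Ck_on_inverse)

lemma smooth_on_powr:
  fixes f :: "'a::real_normed_vector \<Rightarrow> real"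
  shows "open S \<Longrightarrow> (\<And>x. x \<in> S \<Longrightarrow> f x > 0) \<Longrightarrow> smooth_on f S \<Longrightarrow> smooth_on (\<lambda>x. f x powr a) S"
  by (simp add: smooth_on_def Ck_on_powr)

lemmas smooth_on_scaleR = smooth_on_bilinear[OF bounded_bilinear_scaleR]
lemmas smooth_on_mult = smooth_on_bilinear[OF bounded_bilinear_mult]
lemmas smooth_on_inner_left = smooth_on_linear[OF bounded_linear_inner_left]

lemma smooth_on_cong:
  "open S \<Longrightarrow> (\<And>x. x \<in> S \<Longrightarrow> f x = g x) \<Longrightarrow> smooth_on f S \<Longrightarrow> smooth_on g S"
  unfolding smooth_on_def by (meson Ck_on_cong)

lemma smooth_on_subset:
  assumes "smooth_on f S" "T \<subseteq> S"
  shows "smooth_on f T"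
proof -
  have "Ck_on k f S \<Longrightarrow> Ck_on k f T" for k
    by (induction k arbitrary: f) (use assms(2) in \<open>auto intro: continuous_on_subset\<close>)
  with assms(1) show ?thesis by (auto simp: smooth_on_def)
qed

lemma smooth_on_imp_continuous_on: "smooth_on f S \<Longrightarrow> continuous_on S f"
  unfolding smooth_on_def by (metis Ck_on.simps(1))

lemma smooth_on_has_derivative:
  "smooth_on f S \<Longrightarrow> x \<in> S \<Longrightarrow> (f has_derivative frechet_derivative f (at x)) (at x)"
  unfolding smooth_on_def by (metis Ck_on_Suc_derivative)

lemma diffeomorphismI:
  assumes "open U" "open W" "\<And>x. x \<in> U \<Longrightarrow> \<phi> x \<in> W \<and> \<psi> (\<phi> x) = x"
    "\<And>y. y \<in> W \<Longrightarrow> \<psi> y \<in> U \<and> \<phi> (\<psi> y) = y" "smooth_on \<phi> U" "smooth_on \<psi> W"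
  shows "diffeomorphism \<phi> U W"
proof -
  have bij: "bij_betw \<phi> U W"
    by (rule bij_betwI[where g = \<psi>]) (use assms in auto)
  have "inv_into U \<phi> y = \<psi> y" if "y \<in> W" for y
    using bij assms(4)[OF that] by (metis bij_betw_inv_into_left)
  then have "smooth_on (inv_into U \<phi>) W"
    using smooth_on_cong[OF assms(2) _ assms(6)] by metis
  with bij assms show ?thesis by (simp add: diffeomorphism_def)
qed

section \<open>Foliations whose leaves meet small charts in single slices\<close>

lemma convex_slice: "convex {x \<in> box a b. \<forall>i\<in>J. x \<bullet> i = c \<bullet> i}"
proof -
  have "{x \<in> box a b. \<forall>i\<in>J. x \<bullet> i = c \<bullet> i} = box a b \<inter> (\<Inter>i\<in>J. {x. i \<bullet> x = c \<bullet> i})"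
    by (auto simp: inner_commute)
  then show ?thesis by (auto intro!: convex_Int convex_INT convex_hyperplane)
qed

text \<open>The stronger chart property that holds for both foliations of interest: two points
of the chart domain lie on the same leaf exactly when they lie on the same slice.\<close>

definition slice_chart ::
    "nat \<Rightarrow> 'v::euclidean_space set set \<Rightarrow> ('v \<Rightarrow> 'v set) \<Rightarrow> 'v set \<Rightarrow>
     ('v \<Rightarrow> 'v) \<Rightarrow> 'v \<Rightarrow> 'v \<Rightarrow> 'v set \<Rightarrow> bool" where
  "slice_chart r L T U \<phi> a b I \<longleftrightarrow> I \<subseteq> Basis \<and> card I = r \<and> diffeomorphism \<phi> U (box a b) \<and>
     (\<forall>x\<in>U. \<forall>y\<in>U. (\<exists>l\<in>L. x \<in> l \<and> y \<in> l) \<longleftrightarrow> (\<forall>i\<in>Basis - I. \<phi> x \<bullet> i = \<phi> y \<bullet> i)) \<and>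
     (\<forall>A\<in>U. T A = {v. \<forall>i\<in>Basis - I. frechet_derivative \<phi> (at A) v \<bullet> i = 0})"

text \<open>If each leaf meets a chart in at most one slice, the countability requirement is trivial, and
path-connectedness follows from connectedness: slices are convex, so every leaf is locally
path-connected.\<close>

lemma foliation_if_slice_charts:
  fixes S :: "'v::euclidean_space set"
  assumes "open S" and part: "partition_on S L" and conn: "\<And>l. l \<in> L \<Longrightarrow> connected l"
    and charts: "\<And>A. A \<in> S \<Longrightarrow> \<exists>U \<phi> a b I. A \<in> U \<and> U \<subseteq> S \<and> slice_chart r L T U \<phi> a b I"
  shows "foliation S r L T"
proof -
  have slice: "\<phi> ` (l \<inter> U) = {z \<in> box a b. \<forall>i\<in>Basis - I. z \<bullet> i = \<phi> x \<bullet> i}"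
    if ch: "slice_chart r L T U \<phi> a b I" and l: "l \<in> L" and x: "x \<in> l" "x \<in> U" for \<phi> U a b I l x
  proof -
    have img: "\<phi> ` U = box a b"
      using ch by (simp add: slice_chart_def diffeomorphism_def bij_betw_def)
    have "y \<in> l \<longleftrightarrow> (\<forall>i\<in>Basis - I. \<phi> x \<bullet> i = \<phi> y \<bullet> i)" if "y \<in> U" for y
    proof -
      have "y \<in> l \<longleftrightarrow> (\<exists>l\<in>L. x \<in> l \<and> y \<in> l)"
        using l x partition_onD2[OF part] unfolding disjoint_def by blast
      also have "\<dots> \<longleftrightarrow> (\<forall>i\<in>Basis - I. \<phi> x \<bullet> i = \<phi> y \<bullet> i)"
        using ch x(2) that by (simp add: slice_chart_def)
      finally show ?thesis .
    qed
    then have "\<phi> ` (l \<inter> U) = {z \<in> \<phi> ` U. \<forall>i\<in>Basis - I. z \<bullet> i = \<phi> x \<bullet> i}"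
      by (auto simp: image_iff)
    then show ?thesis by (simp add: img)
  qed
  have "path_connected l" if l: "l \<in> L" for l
  proof -
    have "path_component l x y" if xy: "x \<in> l" "y \<in> l" for x y
    proof (rule connected_equivalence_relation[OF conn[OF l] xy])
      show "\<exists>T. openin (top_of_set l) T \<and> A \<in> T \<and> (\<forall>B\<in>T. path_component l A B)" if A: "A \<in> l" for A
      proof -
        have "A \<in> S" using A l partition_onD1[OF part] by auto
        obtain U \<phi> a b I where U: "A \<in> U" and ch: "slice_chart r L T U \<phi> a b I"
          using charts[OF \<open>A \<in> S\<close>] by (elim exE conjE) (rule that)
        then have d: "diffeomorphism \<phi> U (box a b)" by (simp add: slice_chart_def)
        let ?\<psi> = "inv_into U \<phi>" and ?Z = "{z \<in> box a b. \<forall>i\<in>Basis - I. z \<bullet> i = \<phi> A \<bullet> i}"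
        have "l \<inter> U = ?\<psi> ` \<phi> ` (l \<inter> U)"
          using d by (simp add: diffeomorphism_def bij_betw_def inv_into_image_cancel)
        also have "\<dots> = ?\<psi> ` ?Z" by (simp add: slice[OF ch l A U])
        finally have eq: "l \<inter> U = ?\<psi> ` ?Z" .
        have "continuous_on ?Z ?\<psi>"
          using d by (auto simp: diffeomorphism_def
              intro: continuous_on_subset[OF smooth_on_imp_continuous_on])
        then have "path_connected (l \<inter> U)"
          unfolding eq by (intro path_connected_continuous_image convex_imp_path_connected convex_slice)
        then have "\<forall>B\<in>l \<inter> U. path_component l A B"
          using A U by (meson IntI Int_lower1 path_component_of_subset path_connected_component)
        moreover have "openin (top_of_set l) (l \<inter> U)"
          using d by (simp add: diffeomorphism_def openin_open_Int)
        ultimately show ?thesis using A U by blast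
      qed
    qed (auto intro: path_component_sym path_component_trans)
    then show ?thesis by (simp add: path_connected_component)
  qed
  moreover have "\<exists>U \<phi>. A \<in> U \<and> U \<subseteq> S \<and> flat_chart r L T U \<phi>" if "A \<in> S" for A
  proof -
    obtain U \<phi> a b I where U: "A \<in> U" "U \<subseteq> S" and ch: "slice_chart r L T U \<phi> a b I"
      using charts[OF \<open>A \<in> S\<close>] by (elim exE conjE) (rule that)
    have "\<exists>K. countable K \<and> \<phi> ` (l \<inter> U) = (\<Union>c\<in>K. {x \<in> box a b. \<forall>i\<in>Basis - I. x \<bullet> i = c \<bullet> i})"
      if "l \<in> L" for l
    proof (cases "l \<inter> U = {}")
      case True
      then show ?thesis by (intro exI[of _ "{}"]) auto
    next
      case False
      then obtain x where "x \<in> l" "x \<in> U" by auto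
      then show ?thesis using slice[OF ch that] by (intro exI[of _ "{\<phi> x}"]) auto
    qed
    then have "flat_chart r L T U \<phi>"
      using ch unfolding flat_chart_def slice_chart_def by blast
    then show ?thesis using U by blast
  qed
  ultimately show ?thesis using assms(1) part by (simp add: foliation_def)
qed

text \<open>An explicit pair of mutually inverse smooth maps becomes a chart onto a box after shrinking the
target to a box and the source to its preimage.\<close>

lemma box_chart:
  fixes \<phi> :: "'v::euclidean_space \<Rightarrow> 'v"
  assumes "open W" "open W'" "\<And>x. x \<in> W \<Longrightarrow> \<phi> x \<in> W' \<and> \<psi> (\<phi> x) = x"
    and "\<And>y. y \<in> W' \<Longrightarrow> \<psi> y \<in> W \<and> \<phi> (\<psi> y) = y" "smooth_on \<phi> W" "smooth_on \<psi> W'" "A \<in> W"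
  obtains a b where "\<phi> A \<in> box a b" "box a b \<subseteq> W'"
    "diffeomorphism \<phi> {x \<in> W. \<phi> x \<in> box a b} (box a b)"
proof -
  obtain a b where ab: "box a b \<subseteq> W'" "\<phi> A \<in> box a b"
    using open_contains_box[OF assms(2), of "\<phi> A"] assms(3,7) by metis
  let ?U = "{x \<in> W. \<phi> x \<in> box a b}"
  have "?U = W \<inter> \<phi> -` box a b" by auto
  then have "open ?U"
    using continuous_open_preimage[OF smooth_on_imp_continuous_on[OF assms(5)] assms(1) open_box] by simp
  then have "diffeomorphism \<phi> ?U (box a b)"
    using assms ab(1) by (intro diffeomorphismI[where \<psi> = \<psi>]) (auto intro: smooth_on_subset)
  with ab that show thesis by blast
qed

lemma derivative_of_local_inverse:
  assumes "open U" "x \<in> U" "\<And>x. x \<in> U \<Longrightarrow> \<psi> (\<phi> x) = x"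
    and D: "(\<phi> has_derivative D) (at x)" and E: "(\<psi> has_derivative E) (at (\<phi> x))"
  shows "E (D v) = v"
proof -
  have "((\<lambda>x. \<psi> (\<phi> x)) has_derivative (\<lambda>v. E (D v))) (at x)"
    by (rule has_derivative_compose[OF D E])
  moreover have "((\<lambda>x. \<psi> (\<phi> x)) has_derivative (\<lambda>v. v)) (at x)"
    by (rule has_derivative_transform_within_open[OF has_derivative_ident assms(1,2)])
      (simp add: assms(3))
  ultimately show ?thesis using has_derivative_unique by metis
qed

section \<open>Exponentials of endomorphisms\<close>

lemma norm_funpow_le:
  fixes f :: "'v::real_normed_vector \<Rightarrow> 'v"
  assumes "\<And>v. norm (f v) \<le> K * norm v" "0 \<le> K"
  shows "norm ((f ^^ n) v) \<le> K ^ n * norm v"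
proof (induction n)
  case (Suc n)
  have "norm ((f ^^ Suc n) v) \<le> K * norm ((f ^^ n) v)" using assms(1) by simp
  also have "\<dots> \<le> K * (K ^ n * norm v)" using Suc assms(2) by (rule mult_left_mono)
  finally show ?case by (simp add: mult.assoc)
qed auto

lemma norm_exp_endo_term_le:
  fixes f :: "'v::real_normed_vector \<Rightarrow> 'v"
  assumes "\<And>v. norm (f v) \<le> K * norm v" "0 \<le> K"
  shows "norm ((1 / fact n) *\<^sub>R (f ^^ n) v) \<le> (inverse (fact n) * K ^ n) * norm v"
  using mult_left_mono[OF norm_funpow_le[OF assms, of n v], of "inverse (fact n)"]
  by (simp add: field_simps)

lemma summable_exp_endo:
  fixes f :: "'v::euclidean_space \<Rightarrow> 'v"
  assumes "linear f"
  shows "summable (\<lambda>n. (1 / fact n) *\<^sub>R (f ^^ n) v)"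
proof -
  obtain K where K: "0 < K" "\<And>v. norm (f v) \<le> K * norm v"
    using linear_bounded_pos[OF assms] by blast
  have "summable (\<lambda>n. (inverse (fact n) * K ^ n) * norm v)"
    by (intro summable_mult2 summable_exp)
  then show ?thesis
  proof (rule summable_comparison_test')
    show "norm ((1 / fact n) *\<^sub>R (f ^^ n) v) \<le> (inverse (fact n) * K ^ n) * norm v" for n
      using K by (intro norm_exp_endo_term_le) auto
  qed
qed

lemma exp_endo_commute:
  fixes f :: "'v::euclidean_space \<Rightarrow> 'v"
  assumes "linear f"
  shows "f (exp_endo f v) = exp_endo f (f v)"
proof -
  have "f (exp_endo f v) = (\<Sum>n. f ((1 / fact n) *\<^sub>R (f ^^ n) v))"
    unfolding exp_endo_def
    using bounded_linear.suminf[OF linear_conv_bounded_linear[THEN iffD1, OF assms] summable_exp_endo[OF assms]] .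
  also have "\<dots> = exp_endo f (f v)"
    unfolding exp_endo_def by (simp add: linear_scale[OF assms] funpow_swap1)
  finally show ?thesis .
qed

lemma linear_funpow:
  fixes f :: "'v::real_vector \<Rightarrow> 'v"
  assumes "linear f"
  shows "linear (f ^^ n)"
proof (induction n)
  case (Suc n)
  then show ?case using linear_compose[OF _ assms] by (simp add: o_def)
qed (simp add: linear_ident)

lemma linear_funpow_scaleR:
  fixes f :: "'v::real_vector \<Rightarrow> 'v"
  assumes "linear f"
  shows "((\<lambda>v. t *\<^sub>R f v) ^^ n) v = t ^ n *\<^sub>R (f ^^ n) v"
  by (induction n) (simp_all add: linear_scale[OF assms])

lemma exp_endo_0: "exp_endo (\<lambda>v. 0) v = v"
proof -
  have "(1 / fact n) *\<^sub>R ((\<lambda>v. 0) ^^ n) v = (if n = 0 then v else 0)" for n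
    by (cases n) auto
  then show ?thesis unfolding exp_endo_def using sums_single[of 0 "\<lambda>_. v"] by (simp add: sums_iff)
qed

text \<open>Each coordinate of \<open>t \<mapsto> exp (t f) v\<close> is a real power series that converges everywhere and may be
differentiated term by term. This gives \<open>exp (t f) (f v)\<close>; the factor \<open>f\<close> is then moved outside, since it
commutes with the series.\<close>

lemma exp_endo_has_vector_derivative:
  fixes f :: "'v::euclidean_space \<Rightarrow> 'v"
  assumes "linear f"
  shows "((\<lambda>t. exp_endo (\<lambda>v. t *\<^sub>R f v) v) has_vector_derivative
    f (exp_endo (\<lambda>v. t *\<^sub>R f v) v)) (at t)"
proof -
  have sm: "summable (\<lambda>n. (((f ^^ n) x \<bullet> w) / fact n) * s ^ n)"
    and inn: "exp_endo (\<lambda>v. s *\<^sub>R f v) x \<bullet> w = (\<Sum>n. (((f ^^ n) x \<bullet> w) / fact n) * s ^ n)" for w s x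
  proof -
    let ?a = "\<lambda>n. (1 / fact n) *\<^sub>R ((\<lambda>v. s *\<^sub>R f v) ^^ n) x"
    have s: "summable ?a" by (rule summable_exp_endo[OF linear_compose_scale_right[OF assms]])
    have eq: "?a n \<bullet> w = (((f ^^ n) x \<bullet> w) / fact n) * s ^ n" for n
      by (simp add: linear_funpow_scaleR[OF assms])
    show "summable (\<lambda>n. (((f ^^ n) x \<bullet> w) / fact n) * s ^ n)"
      using bounded_linear.summable[OF bounded_linear_inner_left s, of w] unfolding eq .
    show "exp_endo (\<lambda>v. s *\<^sub>R f v) x \<bullet> w = (\<Sum>n. (((f ^^ n) x \<bullet> w) / fact n) * s ^ n)"
      using bounded_linear.suminf[OF bounded_linear_inner_left s, of w] unfolding eq exp_endo_def .
  qed
  have "((\<lambda>t. exp_endo (\<lambda>v. t *\<^sub>R f v) v \<bullet> w) has_field_derivative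
      exp_endo (\<lambda>v. t *\<^sub>R f v) (f v) \<bullet> w) (at t)" for w
  proof -
    have "diffs (\<lambda>n. ((f ^^ n) v \<bullet> w) / fact n) = (\<lambda>n. ((f ^^ n) (f v) \<bullet> w) / fact n)"
      by (rule ext) (simp add: diffs_def funpow_swap1 field_simps del: of_nat_Suc)
    then show ?thesis
      using termdiffs_strong_converges_everywhere[OF sm, of v w t] by (simp add: inn)
  qed
  then have "((\<lambda>t. exp_endo (\<lambda>v. t *\<^sub>R f v) v) has_vector_derivative
      exp_endo (\<lambda>v. t *\<^sub>R f v) (f v)) (at t)"
    unfolding has_vector_derivative_def has_derivative_componentwise_within[of "\<lambda>t. exp_endo (\<lambda>v. t *\<^sub>R f v) v"]
    unfolding has_field_derivative_def inner_scaleR_left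
    by (simp add: mult.commute[of _ "_ \<bullet> _"])
  moreover have "exp_endo (\<lambda>v. t *\<^sub>R f v) (f v) = f (exp_endo (\<lambda>v. t *\<^sub>R f v) v)"
  proof (cases "t = 0")
    case True
    then show ?thesis by (simp add: exp_endo_0)
  next
    case False
    have "t *\<^sub>R f (exp_endo (\<lambda>v. t *\<^sub>R f v) v) = exp_endo (\<lambda>v. t *\<^sub>R f v) (t *\<^sub>R f v)"
      by (rule exp_endo_commute[OF linear_compose_scale_right[OF assms]])
    also have "\<dots> = t *\<^sub>R exp_endo (\<lambda>v. t *\<^sub>R f v) (f v)"
    proof -
      have "exp_endo (\<lambda>v. t *\<^sub>R f v) (t *\<^sub>R f v) =
          (\<Sum>n. t *\<^sub>R ((1 / fact n) *\<^sub>R ((\<lambda>v. t *\<^sub>R f v) ^^ n) (f v)))"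
        unfolding exp_endo_def linear_funpow_scaleR[OF assms]
        by (simp add: linear_scale[OF linear_funpow[OF assms]] mult_ac)
      also have "\<dots> = t *\<^sub>R exp_endo (\<lambda>v. t *\<^sub>R f v) (f v)"
        unfolding exp_endo_def
        by (rule suminf_scaleR_right[symmetric]) (rule summable_exp_endo[OF linear_compose_scale_right[OF assms]])
      finally show ?thesis .
    qed
    finally show ?thesis using False by simp
  qed
  ultimately show ?thesis by simp
qed

text \<open>Passing to the adjoint turns a composition of two
exponentials into an inner product of two curves.\<close>

lemma exp_endo_adjoint:
  fixes f :: "'v::euclidean_space \<Rightarrow> 'v"
  assumes "linear f"
  shows "x \<bullet> exp_endo (adjoint f) y = exp_endo f x \<bullet> y"
proof -
  have pow: "x \<bullet> (adjoint f ^^ n) y = (f ^^ n) x \<bullet> y" for n x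
    by (induction n arbitrary: x) (simp_all add: adjoint_works[OF assms], metis funpow_swap1)
  have "x \<bullet> exp_endo (adjoint f) y = (\<Sum>n. x \<bullet> ((1 / fact n) *\<^sub>R (adjoint f ^^ n) y))"
    unfolding exp_endo_def
    by (rule bounded_linear.suminf[OF bounded_linear_inner_right
          summable_exp_endo[OF adjoint_linear[OF assms]]])
  also have "\<dots> = (\<Sum>n. ((1 / fact n) *\<^sub>R (f ^^ n) x) \<bullet> y)"
    by (simp add: pow)
  also have "\<dots> = exp_endo f x \<bullet> y"
    unfolding exp_endo_def
    by (rule bounded_linear.suminf[OF bounded_linear_inner_left summable_exp_endo[OF assms], symmetric])
  finally show ?thesis .
qed

text \<open>The inner product of the curves \<open>exp (t f) v\<close> and \<open>exp (- t f\<^sup>*) w\<close> has derivative zero, and comparing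
its values at 0 and 1 gives \<open>exp (- f) (exp f v) \<bullet> w = v \<bullet> w\<close>. This avoids multiplying two exponential series.\<close>

lemma exp_endo_minus:
  fixes f :: "'v::euclidean_space \<Rightarrow> 'v"
  assumes "linear f"
  shows "exp_endo (\<lambda>v. - f v) (exp_endo f v) = v"
proof -
  have la: "linear (adjoint f)" by (rule adjoint_linear[OF assms])
  have "exp_endo (\<lambda>v. - f v) (exp_endo f v) \<bullet> w = v \<bullet> w" for w
  proof -
    let ?u = "\<lambda>t. exp_endo (\<lambda>v. t *\<^sub>R f v) v"
    let ?w = "\<lambda>t. exp_endo (\<lambda>v. t *\<^sub>R (- adjoint f v)) w"
    have du: "(?u has_vector_derivative f (?u t)) (at t)" for t
      by (rule exp_endo_has_vector_derivative[OF assms])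
    have dw: "(?w has_vector_derivative (- adjoint f (?w t))) (at t)" for t
      by (rule exp_endo_has_vector_derivative) (rule linear_compose_neg[OF la])
    have "((\<lambda>t. ?u t \<bullet> ?w t) has_vector_derivative (0::real)) (at t within {0..1})" for t
    proof -
      have "((\<lambda>t. ?u t \<bullet> ?w t) has_vector_derivative ?u t \<bullet> (- adjoint f (?w t)) + f (?u t) \<bullet> ?w t) (at t)"
        by (rule bounded_bilinear.has_vector_derivative[OF bounded_bilinear_inner du dw])
      then show ?thesis
        using adjoint_works[OF assms, of "?u t" "?w t"]
        by (simp add: has_vector_derivative_at_within)
    qed
    then obtain c where "\<And>t. t \<in> {0..1} \<Longrightarrow> ?u t \<bullet> ?w t = c"
      using has_vector_derivative_zero_constant[of "{0..1::real}" "\<lambda>t. ?u t \<bullet> ?w t"] by auto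
    from this[of 0] this[of 1] have "?u 1 \<bullet> ?w 1 = ?u 0 \<bullet> ?w 0" by simp
    then have "exp_endo f v \<bullet> exp_endo (\<lambda>v. - adjoint f v) w = v \<bullet> w"
      by (simp add: exp_endo_0)
    moreover have "adjoint (\<lambda>v. - f v) = (\<lambda>v. - adjoint f v)"
      using adjoint_works[OF assms] by (intro adjoint_unique) auto
    ultimately show ?thesis
      using exp_endo_adjoint[OF linear_compose_neg[OF assms], of "exp_endo f v" w] by simp
  qed
  then show ?thesis by (metis inner_commute vector_eq_rdot)
qed

text \<open>Termwise comparison with the scalar exponential series of the norm bound \<open>K\<close>.\<close>

lemma norm_exp_endo_remainder_le:
  fixes f :: "'v::euclidean_space \<Rightarrow> 'v"
  assumes "linear f" "\<And>v. norm (f v) \<le> K * norm v" "0 \<le> K"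
  shows "norm (exp_endo f v - v - f v) \<le> (exp K - 1 - K) * norm v"
proof -
  let ?a = "\<lambda>n. (1 / fact n) *\<^sub>R (f ^^ n) v"
  let ?b = "\<lambda>n. (inverse (fact n) * K ^ n) * norm v"
  have sb: "summable ?b" by (intro summable_mult2 summable_exp)
  have "(\<Sum>n. ?b n) = exp K * norm v"
    using suminf_mult2[OF summable_exp, of K "norm v"] by (simp add: exp_def divide_inverse)
  then have "(\<Sum>n. ?b (n + 2)) = (exp K - 1 - K) * norm v"
    using suminf_minus_initial_segment[OF sb, of 2] by (simp add: eval_nat_numeral algebra_simps)
  moreover have "(\<Sum>n. ?a (n + 2)) = exp_endo f v - v - f v"
    using suminf_minus_initial_segment[OF summable_exp_endo[OF assms(1), of v], of 2]
    by (simp add: exp_endo_def eval_nat_numeral algebra_simps)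
  moreover have "norm (\<Sum>n. ?a (n + 2)) \<le> (\<Sum>n. ?b (n + 2))"
    by (rule norm_suminf_le[OF norm_exp_endo_term_le[OF assms(2,3)]]) (rule summable_ignore_initial_segment[OF sb])
  ultimately show ?thesis by simp
qed

text \<open>On the unit ball the operators \<open>F x\<close> have a common norm bound, so the series converges uniformly.\<close>

lemma continuous_on_exp_endo:
  fixes F :: "'a::euclidean_space \<Rightarrow> 'v::euclidean_space \<Rightarrow> 'v"
  assumes "bilinear F"
  shows "continuous_on (ball 0 1) (\<lambda>x. exp_endo (F x) v)"
proof -
  obtain K where K: "0 < K" "\<And>x v. norm (F x v) \<le> K * norm x * norm v"
    using bilinear_bounded_pos[OF assms] by blast
  have bb: "bounded_bilinear F" using assms by (simp add: bilinear_conv_bounded_bilinear)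
  have bd: "norm (F x v) \<le> K * norm v" if "x \<in> ball 0 1" for x v
  proof -
    have "K * norm x * norm v \<le> K * 1 * norm v"
      using that K(1) by (intro mult_right_mono mult_left_mono) auto
    with K(2)[of x v] show ?thesis by simp
  qed
  have cont: "continuous_on (ball 0 1) (\<lambda>x. (F x ^^ n) v)" for n
  proof (induction n)
    case (Suc n)
    then show ?case
      using bounded_bilinear.continuous_on[OF bb continuous_on_id] by simp
  qed (simp add: continuous_on_const)
  have "uniform_limit (ball 0 1) (\<lambda>n x. \<Sum>i<n. (1 / fact i) *\<^sub>R (F x ^^ i) v)
      (\<lambda>x. \<Sum>i. (1 / fact i) *\<^sub>R (F x ^^ i) v) sequentially"
  proof (rule Weierstrass_m_test)
    show "norm ((1 / fact n) *\<^sub>R (F x ^^ n) v) \<le> (inverse (fact n) * K ^ n) * norm v"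
      if "x \<in> ball 0 1" for n x
      using bd[OF that] K(1) by (intro norm_exp_endo_term_le) auto
    show "summable (\<lambda>n. (inverse (fact n) * K ^ n) * norm v)"
      by (intro summable_mult2 summable_exp)
  qed
  then show ?thesis
    unfolding exp_endo_def
    by (rule uniform_limit_theorem[rotated])
      (auto intro!: always_eventually continuous_on_sum continuous_on_scaleR continuous_on_const cont)
qed

lemma exp_endo_has_derivative_at_0:
  fixes F :: "'a::euclidean_space \<Rightarrow> 'v::euclidean_space \<Rightarrow> 'v"
  assumes "bilinear F"
  shows "((\<lambda>x. exp_endo (F x) v) has_derivative (\<lambda>x. F x v)) (at 0)"
proof -
  obtain K where K: "0 < K" "\<And>x v. norm (F x v) \<le> K * norm x * norm v"
    using bilinear_bounded_pos[OF assms] by blast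
  have bb: "bounded_bilinear F" using assms by (simp add: bilinear_conv_bounded_bilinear)
  have F0: "F 0 = (\<lambda>v. 0)" using bilinear_lzero[OF assms] by auto
  have "((\<lambda>x. norm (exp_endo (F x) v - exp_endo (F 0) v - F x v) / norm x) \<longlongrightarrow> 0) (at 0)"
  proof (rule tendsto_sandwich[of "\<lambda>_. 0" _ _ "\<lambda>x. K\<^sup>2 * norm v * norm x"])
    show "\<forall>\<^sub>F x in at 0. norm (exp_endo (F x) v - exp_endo (F 0) v - F x v) / norm x
        \<le> K\<^sup>2 * norm v * norm x"
      unfolding eventually_at
    proof (intro exI[of _ "1 / K"] conjI ballI impI)
      fix x :: 'a assume "x \<noteq> 0 \<and> dist x 0 < 1 / K"
      then have x: "norm x > 0" "K * norm x \<le> 1" using K(1) by (auto simp: field_simps)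
      have "norm (exp_endo (F x) v - v - F x v) \<le> (exp (K * norm x) - 1 - K * norm x) * norm v"
        using K assms by (intro norm_exp_endo_remainder_le) (auto simp: bilinear_def)
      also have "\<dots> \<le> (K * norm x)\<^sup>2 * norm v"
        using exp_bound[of "K * norm x"] x K(1) by (intro mult_right_mono) auto
      finally show "norm (exp_endo (F x) v - exp_endo (F 0) v - F x v) / norm x \<le> K\<^sup>2 * norm v * norm x"
        using x(1) by (simp add: F0 exp_endo_0 divide_le_eq power2_eq_square mult_ac)
    qed (use K(1) in auto)
    show "((\<lambda>x. K\<^sup>2 * norm v * norm x) \<longlongrightarrow> 0) (at (0::'a))"
      by (auto intro!: tendsto_eq_intros)
  qed auto
  then show ?thesis
    using bounded_bilinear.bounded_linear_left[OF bb] by (simp add: has_derivative_iff_norm)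
qed

section \<open>The group generated by the exponentials and its orbits\<close>

lemma exp_group_comp: "g \<in> exp_group act \<Longrightarrow> h \<in> exp_group act \<Longrightarrow> g \<circ> h \<in> exp_group act"
  by (induction rule: exp_group.induct) (auto simp: comp_assoc intro: exp_group.intros)

lemma exp_group_exp_endo: "exp_endo (act m) \<in> exp_group act"
  using exp_group_exp[OF exp_group_id, of act m] by simp

text \<open>The group is generated by exponentials alone, so inverses come from \<open>exp (- m)\<close>, one factor at a time.\<close>

lemma exp_group_inverse:
  assumes "bilinear act" "g \<in> exp_group act"
  shows "\<exists>h\<in>exp_group act. \<forall>v. h (g v) = v"
  using assms(2)
proof induction
  case exp_group_id
  show ?case by (rule bexI[OF _ exp_group.exp_group_id]) simp
next
  case (exp_group_exp g m)
  then obtain h where h: "h \<in> exp_group act" "\<And>v. h (g v) = v" by blast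
  have "act (- m) = (\<lambda>v. - act m v)" using bilinear_lneg[OF assms(1)] by auto
  moreover have "linear (act m)" using assms(1) by (simp add: bilinear_def)
  ultimately have "exp_endo (act (- m)) (exp_endo (act m) v) = v" for v
    by (simp add: exp_endo_minus)
  then show ?case
    using exp_group_comp[OF h(1) exp_group_exp_endo[of act "- m"]] h(2)
    by (intro bexI[of _ "h \<circ> exp_endo (act (- m))"]) auto
qed

definition exp_orbit :: "('m \<Rightarrow> 'v::euclidean_space \<Rightarrow> 'v) \<Rightarrow> 'v \<Rightarrow> 'v set" where
  "exp_orbit act A = (\<lambda>g. g A) ` exp_group act"

lemma exp_orbitI: "g \<in> exp_group act \<Longrightarrow> g A \<in> exp_orbit act A"
  by (simp add: exp_orbit_def)

lemma exp_orbitE: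
  assumes "B \<in> exp_orbit act A"
  obtains g where "g \<in> exp_group act" "B = g A"
  using assms by (auto simp: exp_orbit_def)

lemma exp_orbit_self: "A \<in> exp_orbit act A"
  using exp_orbitI[OF exp_group_id, of A act] by simp

lemma exp_orbit_trans: "C \<in> exp_orbit act B \<Longrightarrow> B \<in> exp_orbit act A \<Longrightarrow> C \<in> exp_orbit act A"
  by (elim exp_orbitE) (use exp_orbitI[OF exp_group_comp] in fastforce)

lemma exp_orbit_sym: "bilinear act \<Longrightarrow> B \<in> exp_orbit act A \<Longrightarrow> A \<in> exp_orbit act B"
  by (elim exp_orbitE) (metis exp_group_inverse exp_orbitI)

lemma exp_orbit_eq: "bilinear act \<Longrightarrow> B \<in> exp_orbit act A \<Longrightarrow> exp_orbit act B = exp_orbit act A"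
  using exp_orbit_trans exp_orbit_sym by blast

text \<open>A product of exponentials is joined to the identity by letting the parameter of one factor after the
other run from 1 down to 0.\<close>

lemma path_connected_exp_orbit:
  assumes "bilinear act"
  shows "path_connected (exp_orbit act A)"
proof -
  have "path_component (exp_orbit act A) A (g A)" if "g \<in> exp_group act" for g
    using that
  proof induction
    case exp_group_id
    then show ?case by (simp add: exp_orbit_self path_component_refl)
  next
    case (exp_group_exp g m)
    let ?p = "\<lambda>t. exp_endo (act (t *\<^sub>R m)) (g A)"
    have lin: "linear (act m)" using assms by (simp add: bilinear_def)
    have act: "act (t *\<^sub>R m) = (\<lambda>v. t *\<^sub>R act m v)" for t
      using bilinear_lmul[OF assms] by auto
    have "continuous_on {0..1} ?p"
      using exp_endo_has_vector_derivative[OF lin]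
      by (auto simp: act intro!: continuous_at_imp_continuous_on has_vector_derivative_continuous)
    moreover have "?p t \<in> exp_orbit act A" for t
      using exp_orbitI[OF exp_group.exp_group_exp[OF exp_group_exp.hyps, of "t *\<^sub>R m"], of A] by simp
    moreover have "?p 0 = g A" "?p 1 = exp_endo (act m) (g A)"
      using act[of 0] by (simp_all add: exp_endo_0)
    ultimately have "path_component (exp_orbit act A) (g A) (exp_endo (act m) (g A))"
      unfolding path_component_def path_def path_image_def pathstart_def pathfinish_def by blast
    with exp_group_exp.IH show ?case by (auto intro: path_component_trans)
  qed
  then show ?thesis
    unfolding path_connected_component exp_orbit_def
    by (auto intro: path_component_trans path_component_sym)
qed

section \<open>Algebra of special symplectic representations\<close>

locale special_symplectic =
  fixes br :: "'m::real_vector \<Rightarrow> 'm \<Rightarrow> 'm"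
    and act :: "'m \<Rightarrow> 'v::euclidean_space \<Rightarrow> 'v"
    and \<omega> :: "'v \<Rightarrow> 'v \<Rightarrow> real"
    and B :: "'v \<Rightarrow> 'v \<Rightarrow> 'm"
  assumes ssr: "special_symplectic_rep br act \<omega> B"
begin

abbreviation "Psi \<equiv> ssr_Psi act B"
abbreviation "Q \<equiv> ssr_Q act \<omega> B"

lemma Psi_eq: "Psi A = act (B A A) A"
  by (simp add: ssr_Psi_def ssr_mu_def)

lemma Q_eq: "Q A = 3 / 2 * \<omega> A (Psi A)"
  by (simp add: ssr_Q_def)

lemma bilinear_act: "bilinear act" and bilinear_B: "bilinear B" and bilinear_w: "bilinear \<omega>"
  and bilinear_br: "bilinear br"
  using ssr by (auto simp: special_symplectic_rep_def faithful_representation_def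
      symplectic_form_def lie_bracket_def)

lemmas act_simps = bilinear_ladd[OF bilinear_act] bilinear_radd[OF bilinear_act]
  bilinear_lsub[OF bilinear_act] bilinear_rsub[OF bilinear_act]
  bilinear_lmul[OF bilinear_act] bilinear_rmul[OF bilinear_act]
  bilinear_lzero[OF bilinear_act] bilinear_rzero[OF bilinear_act]
lemmas B_simps = bilinear_ladd[OF bilinear_B] bilinear_radd[OF bilinear_B]
  bilinear_lsub[OF bilinear_B] bilinear_rsub[OF bilinear_B]
  bilinear_lmul[OF bilinear_B] bilinear_rmul[OF bilinear_B]
  bilinear_lzero[OF bilinear_B] bilinear_rzero[OF bilinear_B]
lemmas w_simps = bilinear_ladd[OF bilinear_w] bilinear_radd[OF bilinear_w]
  bilinear_lsub[OF bilinear_w] bilinear_rsub[OF bilinear_w]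
  bilinear_lmul[OF bilinear_w] bilinear_rmul[OF bilinear_w]
  bilinear_lzero[OF bilinear_w] bilinear_rzero[OF bilinear_w]

lemma w_self: "\<omega> u u = 0"
  using ssr by (auto simp: special_symplectic_rep_def symplectic_form_def)

lemma w_skew: "\<omega> u v = - \<omega> v u"
  using w_self[of "u + v"] w_self[of u] w_self[of v] by (simp add: w_simps)

declare w_self [simp]

lemma w_nondegenerate: "(\<And>v. \<omega> u v = 0) \<Longrightarrow> u = 0"
  using ssr by (auto simp: special_symplectic_rep_def symplectic_form_def)

lemma B_commute: "B u v = B v u"
  using ssr by (simp add: special_symplectic_rep_def)

lemma faithful: "(\<And>v. act m v = 0) \<Longrightarrow> m = 0"
proof -
  assume "\<And>v. act m v = 0"
  then have "act m = act 0" by (simp add: fun_eq_iff act_simps)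
  then show "m = 0" using ssr
    by (auto simp: special_symplectic_rep_def faithful_representation_def dest: injD)
qed

lemma w_act: "\<omega> (act m u) v = - \<omega> u (act m v)"
proof -
  have "\<omega> (act m u) v + \<omega> u (act m v) = 0" using ssr by (simp add: special_symplectic_rep_def)
  then show ?thesis by simp
qed

lemma w_act_commute: "\<omega> (act m u) v = \<omega> (act m v) u"
  using w_act[of m u v] w_skew[of u "act m v"] by simp

lemma act_br: "act (br m n) v = act m (act n v) - act n (act m v)"
  using ssr by (simp add: special_symplectic_rep_def faithful_representation_def)

lemma br_B: "br m (B u v) = B (act m u) v + B u (act m v)"
  using ssr by (simp add: special_symplectic_rep_def)

lemma act_B_swap:
  "act (B u v) w = act (B u w) v + \<omega> v w *\<^sub>R u - (\<omega> u v / 2) *\<^sub>R w + (\<omega> u w / 2) *\<^sub>R v"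
proof -
  have "2 *\<^sub>R act (B u v) w - 2 *\<^sub>R act (B u w) v =
      (2 * \<omega> v w) *\<^sub>R u - \<omega> u v *\<^sub>R w + \<omega> u w *\<^sub>R v"
    using ssr by (simp add: special_symplectic_rep_def)
  also have "\<dots> = 2 *\<^sub>R (\<omega> v w *\<^sub>R u - (\<omega> u v / 2) *\<^sub>R w + (\<omega> u w / 2) *\<^sub>R v)"
    by (simp add: algebra_simps)
  finally have "2 *\<^sub>R (act (B u v) w - act (B u w) v) =
      2 *\<^sub>R (\<omega> v w *\<^sub>R u - (\<omega> u v / 2) *\<^sub>R w + (\<omega> u w / 2) *\<^sub>R v)"
    by (simp add: algebra_simps)
  then have "act (B u v) w - act (B u w) v =
      \<omega> v w *\<^sub>R u - (\<omega> u v / 2) *\<^sub>R w + (\<omega> u w / 2) *\<^sub>R v"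
    by (subst (asm) scaleR_cancel_left) simp
  then show ?thesis by (simp add: algebra_simps)
qed

text \<open>The case of the swap identity that is used most: it trades \<open>B A C\<close> for \<open>\<mu>(A)\<close>.\<close>

lemma act_B_self: "act (B A C) A = act (B A A) C - (3 / 2 * \<omega> A C) *\<^sub>R A"
  using act_B_swap[of A C A] by (simp add: w_skew[of C A] algebra_simps flip: scaleR_add_left)

text \<open>Equivariance applied to \<open>[\<mu>(A), \<mu>(A)] = 0\<close>: the map \<open>\<mu>\<close> is constant to first order in the direction \<open>\<Psi> A\<close>.\<close>

lemma B_Psi: "B A (Psi A) = 0"
proof -
  have "br (B A A) (B A A) = 0"
    using ssr by (simp add: special_symplectic_rep_def lie_bracket_def)
  then have "2 *\<^sub>R B A (Psi A) = 0"
    by (simp add: br_B Psi_eq[symmetric] B_commute[of "Psi A"] scaleR_2)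
  then show ?thesis by simp
qed

lemma act_mu_Psi: "act (B A A) (Psi A) = Q A *\<^sub>R A"
  using act_B_self[of A "Psi A"] by (simp add: B_Psi act_simps Q_eq)

text \<open>Obtained by letting \<open>\<mu>(A)\<close> act on the relation \<open>B A (\<Psi> A) = 0\<close>.\<close>

lemma mu_Psi: "B (Psi A) (Psi A) = - (Q A *\<^sub>R B A A)"
proof -
  have "br (B A A) (B A (Psi A)) = 0" by (simp add: B_Psi bilinear_rzero[OF bilinear_br])
  then show ?thesis
    by (simp add: br_B Psi_eq[symmetric] act_mu_Psi B_simps eq_neg_iff_add_eq_0)
qed

text \<open>On the plane spanned by \<open>A\<close> and \<open>\<Psi> A\<close> the quadratic map \<open>\<mu>\<close> is \<open>\<mu>(A)\<close> times the scalar form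
\<open>a\<^sup>2 - b\<^sup>2 Q A\<close>. Hence \<open>\<Psi>\<close> and \<open>Q\<close> are explicit there too, and the conic on which the form is 1 lies
in one fibre of \<open>\<mu>\<close>.\<close>

lemma mu_plane: "B (a *\<^sub>R A + b *\<^sub>R Psi A) (a *\<^sub>R A + b *\<^sub>R Psi A) = (a\<^sup>2 - b\<^sup>2 * Q A) *\<^sub>R B A A"
  by (simp add: B_simps B_Psi B_commute[of "Psi A" A] mu_Psi power2_eq_square algebra_simps)

lemma Psi_plane:
  "Psi (a *\<^sub>R A + b *\<^sub>R Psi A) = (a\<^sup>2 - b\<^sup>2 * Q A) *\<^sub>R (a *\<^sub>R Psi A + (b * Q A) *\<^sub>R A)"
  by (simp only: Psi_eq[of "a *\<^sub>R A + b *\<^sub>R Psi A"] mu_plane act_simps act_mu_Psi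
      Psi_eq[of A, symmetric] scaleR_scaleR scaleR_add_right mult_ac)

lemma Q_plane: "Q (a *\<^sub>R A + b *\<^sub>R Psi A) = (a\<^sup>2 - b\<^sup>2 * Q A)\<^sup>2 * Q A"
proof -
  have "Q (a *\<^sub>R A + b *\<^sub>R Psi A) = 3 / 2 * ((a\<^sup>2 - b\<^sup>2 * Q A) * ((a\<^sup>2 - b\<^sup>2 * Q A) * \<omega> A (Psi A)))"
    unfolding Q_eq[of "a *\<^sub>R A + b *\<^sub>R Psi A"] Psi_plane
    by (simp add: w_simps w_skew[of "Psi A" A] power2_eq_square algebra_simps)
  also have "\<dots> = (a\<^sup>2 - b\<^sup>2 * Q A)\<^sup>2 * (3 / 2 * \<omega> A (Psi A))"
    by (simp add: power2_eq_square)
  finally show ?thesis by (simp only: Q_eq[symmetric])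
qed

lemma Q_scaleR: "Q (s *\<^sub>R A) = s ^ 4 * Q A"
  using Q_plane[of s A 0] by simp

text \<open>Subtracting a multiple of \<open>\<Psi> A\<close> from \<open>v\<close> leaves a vector \<open>v'\<close> of the kernel that is \<open>\<omega>\<close>-orthogonal to \<open>A\<close>.
Then \<open>\<mu>(A)\<close> kills \<open>v'\<close>, so \<open>v'\<close> is also orthogonal to \<open>\<Psi> A\<close>, and two instances of the swap identity
evaluate \<open>B v' (\<Psi> A) \<cdot> A\<close> as two different multiples of \<open>v'\<close>.\<close>

lemma kernel_dmu:
  assumes "Q A \<noteq> 0"
  shows "B A v = 0 \<longleftrightarrow> (\<exists>c. v = c *\<^sub>R Psi A)"
proof
  assume v: "B A v = 0"
  define c where "c = 3 / 2 * \<omega> A v / Q A"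
  define v' where "v' = v - c *\<^sub>R Psi A"
  have Bv': "B A v' = 0" by (simp add: v'_def B_simps v B_Psi)
  have wv': "\<omega> A v' = 0" "\<omega> v' A = 0"
    using assms by (simp_all add: v'_def w_simps c_def Q_eq w_skew[of _ A] field_simps)
  have "act (B A A) v' = 0" using act_B_self[of A v'] by (simp add: Bv' wv' act_simps)
  then have wP: "\<omega> v' (Psi A) = 0" "\<omega> (Psi A) v' = 0"
    using w_act[of "B A A" v' A] w_skew[of v' "Psi A"] by (simp_all add: Psi_eq w_simps)
  have 1: "act (B v' (Psi A)) A = - (\<omega> A (Psi A) *\<^sub>R v')"
    using act_B_swap[of v' A "Psi A"] wv' wP
    by (simp add: B_commute[of v' A] Bv' act_simps eq_neg_iff_add_eq_0)
  have 2: "act (B v' (Psi A)) A = - ((\<omega> A (Psi A) / 2) *\<^sub>R v')"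
    using act_B_swap[of "Psi A" A v'] wv' wP
    by (simp add: B_commute[of "Psi A"] B_Psi act_simps w_skew[of "Psi A" A] eq_neg_iff_add_eq_0)
  have "(\<omega> A (Psi A) / 2) *\<^sub>R v' = \<omega> A (Psi A) *\<^sub>R v'" using 1 2 by simp
  then have "(\<omega> A (Psi A) / 2) *\<^sub>R v' = 0"
    by (metis field_sum_of_halves scaleR_add_left add_cancel_right_right)
  moreover have "\<omega> A (Psi A) \<noteq> 0" using assms by (simp add: Q_eq)
  ultimately have "v' = 0" by simp
  then show "\<exists>c. v = c *\<^sub>R Psi A" by (auto simp: v'_def)
qed (auto simp: B_simps B_Psi)

text \<open>Two applications of the swap identity, whose correction terms cancel. It turns orthogonality
of \<open>u\<close> to \<open>m \<cdot> A\<close> into a statement about the operator \<open>B A u\<close>.\<close>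

lemma w_act_B_symmetric: "\<omega> (act (B x y) A) u = \<omega> (act (B A u) x) y"
proof -
  have 1: "\<omega> (act (B a b) c) z = \<omega> (act (B a c) b) z + \<omega> b c * \<omega> a z
      - \<omega> a b / 2 * \<omega> c z + \<omega> a c / 2 * \<omega> b z" for a b c z
    by (subst act_B_swap) (simp add: w_simps)
  have 2: "\<omega> (act (B x A) y) u = \<omega> (act (B A x) u) y"
    by (simp add: w_act_commute[of _ y u] B_commute[of x])
  show ?thesis
    using 1[of x y A u] 1[of A x u y] 2 w_skew[of y A] w_skew[of x A] w_skew[of y u] w_skew[of A u]
    by (simp add: algebra_simps)
qed

text \<open>In finite dimension a nondegenerate form represents every linear functional; the functional is
given here by an inner product, so that orthogonal projection can be used with it.\<close>

lemma w_riesz: "\<exists>u. \<forall>x. \<omega> x u = x \<bullet> z"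
proof -
  let ?J = "\<lambda>u. \<Sum>i\<in>Basis. \<omega> i u *\<^sub>R i"
  have "linear ?J"
    by (rule linearI) (simp_all add: w_simps scaleR_add_left sum.distrib scaleR_sum_right)
  have J: "x \<bullet> ?J u = \<omega> x u" for x u
  proof -
    have "linear (\<lambda>x. \<omega> x u)" using bilinear_w by (simp add: bilinear_def)
    then have "\<omega> (\<Sum>i\<in>Basis. (x \<bullet> i) *\<^sub>R i) u = (\<Sum>i\<in>Basis. (x \<bullet> i) * \<omega> i u)"
      by (subst linear_sum) (simp_all add: w_simps)
    then show ?thesis
      by (simp add: euclidean_representation inner_sum_right mult.commute)
  qed
  have "inj ?J"
    unfolding linear_injective_0[OF \<open>linear ?J\<close>]
  proof (intro allI impI)
    fix u assume "?J u = 0"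
    then have "\<omega> u x = 0" for x using J[of x u] w_skew[of u x] by simp
    then show "u = 0" by (rule w_nondegenerate)
  qed
  then have "surj ?J" using \<open>linear ?J\<close> linear_injective_imp_surjective by blast
  from surjD[OF this, of z] obtain u where "z = ?J u" by (elim exE)
  then show ?thesis using J by auto
qed

text \<open>The infinitesimal invariance of \<open>Q\<close>. The number \<open>\<omega> A (\<mu>(A) \<cdot> m \<cdot> A)\<close> is computed in two ways from
\<open>[m, \<mu>(A)]\<close>, once by equivariance and once as a commutator; the results are \<open>2 x\<close> and \<open>- 2 x\<close>.\<close>

lemma w_act_Psi: "\<omega> (act m A) (Psi A) = 0"
proof -
  let ?\<mu> = "B A A"
  have "act (br m ?\<mu>) A = act m (act ?\<mu> A) - act ?\<mu> (act m A)" by (rule act_br)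
  moreover have "act (br m ?\<mu>) A = 2 *\<^sub>R act (B A (act m A)) A"
    by (simp add: br_B B_commute[of "act m A"] act_simps scaleR_2)
  ultimately have "2 * \<omega> A (act (B A (act m A)) A) =
      \<omega> A (act m (act ?\<mu> A)) - \<omega> A (act ?\<mu> (act m A))"
    by (metis w_simps(4) w_simps(6) real_scaleR_def)
  moreover have "\<omega> A (act (B A (act m A)) A) = \<omega> A (act ?\<mu> (act m A))"
    by (simp add: act_B_self w_simps)
  moreover have "\<omega> A (act m (act ?\<mu> A)) = - \<omega> A (act ?\<mu> (act m A))"
    using w_act[of m A "act ?\<mu> A"] w_act[of ?\<mu> "act m A" A] w_skew[of A "act ?\<mu> (act m A)"]
    by simp
  ultimately have "\<omega> A (act ?\<mu> (act m A)) = 0" by simp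
  then show ?thesis
    using w_act[of ?\<mu> "act m A" A] w_skew[of A "act ?\<mu> (act m A)"] by (simp add: Psi_eq)
qed

text \<open>One inclusion is the invariance of \<open>Q\<close>. If the other failed, a functional vanishing on \<open>m \<cdot> A\<close>
but not on \<open>v\<close> would be represented by some \<open>u\<close>; symmetry and faithfulness give \<open>B A u = 0\<close>, so \<open>u\<close> is
a multiple of \<open>\<Psi> A\<close> and the functional vanishes on \<open>v\<close> after all.\<close>

lemma orbit_tangent:
  assumes "Q A \<noteq> 0"
  shows "range (\<lambda>m. act m A) = {v. \<omega> v (Psi A) = 0}"
proof
  show "range (\<lambda>m. act m A) \<subseteq> {v. \<omega> v (Psi A) = 0}" by (auto simp: w_act_Psi)
  show "{v. \<omega> v (Psi A) = 0} \<subseteq> range (\<lambda>m. act m A)"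
  proof
    fix v assume v: "v \<in> {v. \<omega> v (Psi A) = 0}"
    have "linear (\<lambda>m. act m A)" using bilinear_act by (simp add: bilinear_def)
    then have sub: "subspace (range (\<lambda>m. act m A))"
      by (rule linear_subspace_image) (rule subspace_UNIV)
    obtain y z where y: "y \<in> range (\<lambda>m. act m A)" and vyz: "v = y + z"
      and z: "\<And>w. w \<in> range (\<lambda>m. act m A) \<Longrightarrow> orthogonal z w"
      using orthogonal_subspace_decomp_exists[of "range (\<lambda>m. act m A)" v]
      unfolding span_eq_iff[THEN iffD2, OF sub] by metis
    obtain u where u: "\<And>x. \<omega> x u = x \<bullet> z" using w_riesz by blast
    have perp: "\<omega> (act m A) u = 0" for m
      using z[of "act m A"] by (simp add: u orthogonal_def inner_commute)
    have "\<omega> (act (B A u) x) y = 0" for x y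
      using w_act_B_symmetric[of x y A u] perp by simp
    then have "B A u = 0" by (intro faithful w_nondegenerate)
    then obtain c where "u = c *\<^sub>R Psi A" using kernel_dmu[OF assms] by auto
    then have "v \<bullet> z = 0" using v u[of v] by (simp add: w_simps)
    moreover have "y \<bullet> z = 0" using z[OF y] by (simp add: orthogonal_def inner_commute)
    ultimately have "z = 0" by (simp add: vyz inner_add_left)
    then show "v \<in> range (\<lambda>m. act m A)" using y vyz by simp
  qed
qed

text \<open>The Lie algebra carries no topology, so \<open>B u v\<close> is studied through the operator by which it acts;
by faithfulness nothing is lost.\<close>

definition actB :: "'v \<Rightarrow> 'v \<Rightarrow> 'v \<Rightarrow>\<^sub>L 'v" where
  "actB u v = Blinfun (act (B u v))"

lemma actB_apply: "blinfun_apply (actB u v) w = act (B u v) w"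
proof -
  have "bounded_linear (act m)" for m
    using bilinear_act by (simp add: bilinear_def linear_conv_bounded_linear)
  then show ?thesis by (simp add: actB_def bounded_linear_Blinfun_apply)
qed

lemma bounded_bilinear_actB: "bounded_bilinear actB"
  unfolding bilinear_conv_bounded_bilinear[symmetric] bilinear_def
  by (auto intro!: linearI blinfun_eqI
      simp: actB_apply B_simps act_simps blinfun.add_left blinfun.scaleR_left)

lemma bounded_bilinear_w: "bounded_bilinear \<omega>"
  using bilinear_w by (simp add: bilinear_conv_bounded_bilinear)

lemma smooth_on_Psi:
  assumes "open S" "smooth_on f S"
  shows "smooth_on (\<lambda>x. Psi (f x)) S"
  unfolding Psi_eq actB_apply[symmetric]
  by (intro smooth_on_bilinear[OF bounded_bilinear_blinfun_apply]
      smooth_on_bilinear[OF bounded_bilinear_actB] assms)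

lemma smooth_on_Q:
  assumes "open S" "smooth_on f S"
  shows "smooth_on (\<lambda>x. Q (f x)) S"
  unfolding Q_eq
  by (intro smooth_on_mult smooth_on_const smooth_on_bilinear[OF bounded_bilinear_w] smooth_on_Psi assms)

lemma Q_has_derivative: "(Q has_derivative (\<lambda>v. 6 * \<omega> v (Psi A))) (at A)"
proof -
  have "((\<lambda>A. actB A A) has_derivative (\<lambda>v. actB A v + actB v A)) (at A)"
    by (rule bounded_bilinear.FDERIV[OF bounded_bilinear_actB has_derivative_ident has_derivative_ident])
  \<comment> \<open>\<open>\<Psi>\<close> and \<open>Q\<close> are built from \<open>actB\<close> by bilinear operations, so the product rule applies twice.\<close>
  from bounded_bilinear.FDERIV[OF bounded_bilinear_blinfun_apply this has_derivative_ident]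
  have "(Psi has_derivative (\<lambda>v. act (B A A) v + (act (B A v) A + act (B v A) A))) (at A)"
    by (simp add: actB_apply blinfun.add_left Psi_eq[abs_def])
  moreover have "act (B A v) A + act (B v A) A = 2 *\<^sub>R act (B A v) A" for v
    by (simp add: B_commute[of v A] scaleR_2)
  ultimately have "(Psi has_derivative (\<lambda>v. act (B A A) v + 2 *\<^sub>R act (B A v) A)) (at A)"
    by simp
  from has_derivative_mult_right[OF bounded_bilinear.FDERIV[OF bounded_bilinear_w has_derivative_ident this], of "3/2"]
  have "(Q has_derivative (\<lambda>v. 3 / 2 * (\<omega> A (act (B A A) v + 2 *\<^sub>R act (B A v) A) + \<omega> v (Psi A)))) (at A)"
    by (simp only: Q_eq[abs_def])
  moreover have "\<omega> A (act (B A v) A) = \<omega> v (Psi A)" for v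
    using w_act[of "B A A" A v] w_skew[of v "Psi A"] by (simp add: act_B_self[of A v] w_simps Psi_eq)
  moreover have "\<omega> A (act (B A A) v) = \<omega> v (Psi A)" for v
    using w_act[of "B A A" A v] w_skew[of v "Psi A"] by (simp add: Psi_eq)
  ultimately show ?thesis by (simp add: w_simps)
qed

lemma continuous_on_Q: "continuous_on S Q"
  using smooth_on_imp_continuous_on[OF smooth_on_Q[OF open_UNIV smooth_on_ident[OF open_UNIV]]]
  by (auto intro: continuous_on_subset)

lemma linear_act: "linear (act m)"
  using bilinear_act by (simp add: bilinear_def)

lemma Q_exp_endo: "Q (exp_endo (act m) A) = Q A"
proof -
  let ?u = "\<lambda>t. exp_endo (\<lambda>v. t *\<^sub>R act m v) A"
  have "((\<lambda>t. Q (?u t)) has_field_derivative 0) (at t)" for t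
  proof -
    have "(?u has_derivative (\<lambda>s. s *\<^sub>R act m (?u t))) (at t)"
      using exp_endo_has_vector_derivative[OF linear_act] by (simp add: has_vector_derivative_def)
    from has_derivative_compose[OF this Q_has_derivative]
    show ?thesis by (simp add: has_field_derivative_def w_simps w_act_Psi lambda_zero[symmetric])
  qed
  then have "Q (?u 1) = Q (?u 0)" by (intro DERIV_isconst_all) blast
  then show ?thesis by (simp add: exp_endo_0)
qed

lemma Q_exp_orbit:
  assumes "C \<in> exp_orbit act A"
  shows "Q C = Q A"
proof -
  have "Q (g A) = Q A" if "g \<in> exp_group act" for g
    using that by induction (simp_all add: Q_exp_endo)
  with assms show ?thesis by (auto elim: exp_orbitE)
qed

section \<open>The foliation by orbits\<close>

text \<open>Choose \<open>m x\<close> linear in \<open>x\<close> with \<open>m x \<cdot> A = x - \<kappa> x A\<close>, the projection of \<open>x\<close> to the tangent space of the orbit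
along \<open>A\<close>. The map \<open>x \<mapsto> (1 + \<kappa> x) exp (m x) A\<close> then has derivative the identity at 0, so it covers a
neighbourhood of \<open>A\<close>. Since \<open>Q\<close> is homogeneous of degree four and invariant under the exponentials, the
value of \<open>Q\<close> at an image point determines the positive scaling factor, which is 1 on the level set of \<open>A\<close>.\<close>

lemma exp_orbit_open_in_level_set:
  assumes "Q A \<noteq> 0"
  obtains N where "open N" "A \<in> N" "\<And>C. C \<in> N \<Longrightarrow> Q C = Q A \<Longrightarrow> C \<in> exp_orbit act A"
proof -
  have wA: "\<omega> A (Psi A) \<noteq> 0" using assms by (simp add: Q_eq)
  define \<kappa> where "\<kappa> x = \<omega> x (Psi A) / \<omega> A (Psi A)" for x
  have lin\<kappa>: "linear \<kappa>"
    by (rule linearI) (simp_all add: \<kappa>_def w_simps add_divide_distrib)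
  have "\<exists>m. act m A = i - \<kappa> i *\<^sub>R A" for i
  proof -
    have "\<omega> (i - \<kappa> i *\<^sub>R A) (Psi A) = 0" using wA by (simp add: w_simps \<kappa>_def)
    then have "i - \<kappa> i *\<^sub>R A \<in> range (\<lambda>m. act m A)" by (simp add: orbit_tangent[OF assms])
    then show ?thesis by (auto simp: image_iff eq_commute)
  qed
  then obtain m0 where m0: "\<And>i. act (m0 i) A = i - \<kappa> i *\<^sub>R A" by metis
  define m where "m x = (\<Sum>i\<in>Basis. (x \<bullet> i) *\<^sub>R m0 i)" for x
  have linm: "linear m"
    by (rule linearI) (simp_all add: m_def inner_add_left scaleR_add_left sum.distrib scaleR_sum_right)
  have "(\<lambda>x. act (m x) A) = (\<lambda>x. x - \<kappa> x *\<^sub>R A)"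
  proof (rule linear_eq_stdbasis)
    have "linear (\<lambda>m. act m A)" using bilinear_act by (simp add: bilinear_def)
    then show "linear (\<lambda>x. act (m x) A)" using linear_compose[OF linm] by (simp add: o_def)
    show "linear (\<lambda>x. x - \<kappa> x *\<^sub>R A)"
      by (rule linearI) (simp_all add: linear_add[OF lin\<kappa>] linear_scale[OF lin\<kappa>] algebra_simps)
    show "act (m b) A = b - \<kappa> b *\<^sub>R A" if "b \<in> Basis" for b
    proof -
      have "m b = (\<Sum>i\<in>Basis. if i = b then m0 i else 0)"
        unfolding m_def by (rule sum.cong) (use that in \<open>auto simp: inner_Basis\<close>)
      then show ?thesis using that m0 by simp
    qed
  qed
  then have mA: "act (m x) A = x - \<kappa> x *\<^sub>R A" for x by meson
  define F where "F x = act (m x)" for x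
  have bilF: "bilinear F"
    unfolding bilinear_def F_def
    by (auto intro!: linearI simp: linear_add[OF linm] linear_scale[OF linm] act_simps)
  have F0: "F 0 = (\<lambda>v. 0)" using bilinear_lzero[OF bilF] by auto
  define f where "f x = (1 + \<kappa> x) *\<^sub>R exp_endo (F x) A" for x
  have \<kappa>0: "\<kappa> 0 = 0" by (rule linear_0[OF lin\<kappa>])
  have bl\<kappa>: "bounded_linear \<kappa>" using lin\<kappa> by (simp add: linear_conv_bounded_linear)
  have cont\<kappa>: "continuous_on S (\<lambda>x. 1 + \<kappa> x)" for S
    by (intro continuous_on_add continuous_on_const bounded_linear.continuous_on[OF bl\<kappa>] continuous_on_id)
  have "((\<lambda>x. 1 + \<kappa> x) has_derivative (\<lambda>x. 0 + \<kappa> x)) (at 0)"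
    by (rule has_derivative_add[OF has_derivative_const bounded_linear_imp_has_derivative[OF bl\<kappa>]])
  from has_derivative_scaleR[OF this exp_endo_has_derivative_at_0[OF bilF, of A]]
  have derf: "(f has_derivative id) (at 0)"
    unfolding f_def[abs_def] by (rule has_derivative_eq_rhs) (auto simp: \<kappa>0 F0 exp_endo_0, simp add: F_def mA fun_eq_iff)
  define T where "T = ball 0 1 \<inter> {x. 0 < 1 + \<kappa> x}"
  have "open T" unfolding T_def
    by (intro open_Int open_ball open_Collect_less continuous_on_const cont\<kappa>)
  moreover have "0 \<in> T" by (simp add: T_def \<kappa>0)
  ultimately have "0 \<in> interior T" by (simp add: interior_open)
  have "f 0 \<in> interior (f ` T)"
  proof (rule sussmann_open_mapping[OF open_ball _ _ derf])
    show "continuous_on (ball 0 1) f"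
      unfolding f_def[abs_def]
      by (intro continuous_on_scaleR cont\<kappa> continuous_on_exp_endo[OF bilF])
    show "T \<subseteq> ball 0 1" by (simp add: T_def)
    show "bounded_linear (\<lambda>x::'v. x)" by (rule bounded_linear_ident)
  qed (use \<open>0 \<in> interior T\<close> in auto)
  then have "A \<in> interior (f ` T)" by (simp add: f_def \<kappa>0 F0 exp_endo_0)
  moreover have "C \<in> exp_orbit act A" if "C \<in> interior (f ` T)" "Q C = Q A" for C
  proof -
    have "C \<in> f ` T" using that(1) interior_subset by blast
    then obtain x where x: "x \<in> T" "C = f x" by blast
    have "(1 + \<kappa> x) ^ 4 * Q A = Q A"
      using that(2) by (simp add: x f_def Q_scaleR Q_exp_endo F_def)
    then have "(1 + \<kappa> x) ^ 4 = 1 ^ 4" using assms by simp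
    moreover have "0 \<le> 1 + \<kappa> x" using x(1) by (simp add: T_def)
    ultimately have "1 + \<kappa> x = 1" using power_eq_imp_eq_base[of "1 + \<kappa> x" 4 1] by simp
    then have "C = exp_endo (act (m x)) A" by (simp add: x(2) f_def F_def)
    then show ?thesis by (simp only: exp_orbitI[OF exp_group_exp_endo])
  qed
  ultimately show thesis using that open_interior by blast
qed

lemma G_leaves_eq: "G_leaves act \<omega> B = exp_orbit act ` ssr_domain act \<omega> B"
  by (simp add: G_leaves_def exp_orbit_def[abs_def])

lemma partition_G_leaves: "partition_on (ssr_domain act \<omega> B) (G_leaves act \<omega> B)"
proof (rule partition_onI)
  show "\<Union> (G_leaves act \<omega> B) = ssr_domain act \<omega> B"
    using Q_exp_orbit exp_orbit_self by (fastforce simp: G_leaves_eq ssr_domain_def)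
  show "disjnt p q" if pq: "p \<in> G_leaves act \<omega> B" "q \<in> G_leaves act \<omega> B" "p \<noteq> q" for p q
  proof -
    obtain A C where AC: "p = exp_orbit act A" "q = exp_orbit act C"
      using pq by (auto simp: G_leaves_eq)
    show ?thesis
      using exp_orbit_eq[OF bilinear_act, of _ A] exp_orbit_eq[OF bilinear_act, of _ C] pq(3)
      unfolding AC disjnt_iff by metis
  qed
  show "{} \<notin> G_leaves act \<omega> B" using exp_orbit_self by (force simp: G_leaves_eq)
qed

text \<open>Within the connected set the orbits are open, so they cannot split it.\<close>

lemma same_orbit_if_connected_in_level_set:
  assumes "connected Z" "A \<in> Z" "C \<in> Z" "q \<noteq> 0" "\<And>x. x \<in> Z \<Longrightarrow> Q x = q"
  shows "C \<in> exp_orbit act A"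
proof (rule connected_equivalence_relation[OF assms(1-3), where R = "\<lambda>x y. y \<in> exp_orbit act x"])
  show "\<exists>T. openin (top_of_set Z) T \<and> x \<in> T \<and> (\<forall>y\<in>T. y \<in> exp_orbit act x)" if x: "x \<in> Z" for x
  proof -
    obtain N where N: "open N" "x \<in> N" "\<And>C. C \<in> N \<Longrightarrow> Q C = Q x \<Longrightarrow> C \<in> exp_orbit act x"
      using exp_orbit_open_in_level_set[of x] assms(4,5) x by metis
    then show ?thesis using x assms(5) by (intro exI[of _ "Z \<inter> N"]) (auto simp: openin_open_Int)
  qed
qed (auto intro: exp_orbit_sym[OF bilinear_act] exp_orbit_trans)

text \<open>The chart records \<open>Q A\<close> in the coordinate \<open>i0\<close> and the ratios \<open>(A \<bullet> i) / (A \<bullet> i0)\<close> in the others. It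
is inverted by taking the vector \<open>z\<close> with these ratios and \<open>z \<bullet> i0 = 1\<close> and rescaling it by the fourth root
that produces the right value of \<open>Q\<close>; the sign \<open>\<sigma>\<close> selects the root.\<close>

lemma slice_chart_G:
  assumes A0: "Q A0 \<noteq> 0"
  shows "\<exists>U \<phi> a b I. A0 \<in> U \<and> U \<subseteq> ssr_domain act \<omega> B \<and>
    slice_chart (DIM('v) - 1) (G_leaves act \<omega> B) (G_tangent act) U \<phi> a b I"
proof -
  have "A0 \<noteq> 0" using A0 by (auto simp: Q_eq w_simps)
  then obtain i0 where i0: "i0 \<in> Basis" "A0 \<bullet> i0 \<noteq> 0" by (metis euclidean_all_zero_iff)
  define \<sigma> where "\<sigma> = sgn (A0 \<bullet> i0)"
  have \<sigma>: "\<sigma> \<noteq> 0" "\<bar>x\<bar> * \<sigma> = x" if "0 < \<sigma> * x" for x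
    using that i0(2) by (auto simp: \<sigma>_def sgn_if zero_less_mult_iff split: if_splits)
  have \<sigma>4: "\<sigma> ^ 4 = 1" using i0(2) by (simp add: \<sigma>_def sgn_if)
  have \<sigma>2: "\<sigma> * \<sigma> = 1" using i0(2) by (simp add: \<sigma>_def sgn_if)
  have ii: "i0 \<bullet> i0 = 1" using i0(1) by simp
  define W where "W = {A. Q A \<noteq> 0 \<and> 0 < \<sigma> * (A \<bullet> i0)}"
  define \<phi> where "\<phi> A = inverse (A \<bullet> i0) *\<^sub>R A + (Q A - 1) *\<^sub>R i0" for A
  define z where "z x = x + (1 - x \<bullet> i0) *\<^sub>R i0" for x
  define W' where "W' = {x. 0 < (x \<bullet> i0) * Q (z x)}"
  define r where "r x = (x \<bullet> i0) * inverse (Q (z x))" for x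
  define \<psi> where "\<psi> x = (\<sigma> * r x powr (1 / 4)) *\<^sub>R z x" for x
  have smz: "smooth_on z S" if "open S" for S
    unfolding z_def[abs_def] using that
    by (intro smooth_on_add smooth_on_scaleR smooth_on_diff smooth_on_inner_left smooth_on_const smooth_on_ident)
  have contQz: "continuous_on UNIV (\<lambda>x. Q (z x))"
    by (intro smooth_on_imp_continuous_on smooth_on_Q smz open_UNIV)
  have oW: "open W"
    unfolding W_def by (intro open_Collect_conj open_Collect_neq open_Collect_less continuous_intros continuous_on_Q)
  have oW': "open W'"
    unfolding W'_def by (intro open_Collect_less continuous_intros contQz)
  have \<phi>i: "\<phi> A \<bullet> i0 = Q A" if "A \<in> W" for A
  proof -
    have "A \<bullet> i0 \<noteq> 0" using that by (auto simp: W_def)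
    then show ?thesis by (simp add: \<phi>_def inner_add_left ii)
  qed
  have z\<phi>: "z (\<phi> A) = inverse (A \<bullet> i0) *\<^sub>R A" if "A \<in> W" for A
    unfolding z_def \<phi>i[OF that] by (simp add: \<phi>_def algebra_simps)
  have fwd: "\<phi> A \<in> W' \<and> \<psi> (\<phi> A) = A" if A: "A \<in> W" for A
  proof
    have nz: "A \<bullet> i0 \<noteq> 0" "Q A \<noteq> 0" using A by (auto simp: W_def)
    have Qz: "Q (z (\<phi> A)) = inverse (A \<bullet> i0) ^ 4 * Q A" by (simp add: z\<phi>[OF A] Q_scaleR)
    have "0 < inverse (A \<bullet> i0) ^ 4 * (Q A)\<^sup>2" using nz by (intro mult_pos_pos) (auto simp: zero_less_power_eq)
    then show "\<phi> A \<in> W'" by (simp add: W'_def \<phi>i[OF A] Qz power2_eq_square mult_ac)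
    have "r (\<phi> A) = \<bar>A \<bullet> i0\<bar> ^ 4"
      using nz by (simp add: r_def \<phi>i[OF A] Qz field_simps)
    then have "r (\<phi> A) powr (1 / 4) = \<bar>A \<bullet> i0\<bar>"
      using nz powr_powr[of "\<bar>A \<bullet> i0\<bar>" 4 "1/4"] by simp
    moreover have "\<sigma> * \<bar>A \<bullet> i0\<bar> = A \<bullet> i0"
      using A \<sigma>(2)[of "A \<bullet> i0"] by (simp add: W_def mult.commute)
    ultimately show "\<psi> (\<phi> A) = A" using nz by (simp add: \<psi>_def z\<phi>[OF A])
  qed
  have bwd: "\<psi> x \<in> W \<and> \<phi> (\<psi> x) = x" if x: "x \<in> W'" for x
  proof
    have Qz: "Q (z x) \<noteq> 0" and rpos: "0 < r x"
      using x by (auto simp: W'_def r_def zero_less_mult_iff)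
    have zi: "z x \<bullet> i0 = 1" by (simp add: z_def inner_add_left ii)
    let ?s = "\<sigma> * r x powr (1 / 4)"
    have s: "0 < \<sigma> * ?s" "?s \<noteq> 0" using rpos \<sigma>2 by (auto simp flip: mult.assoc)
    have "(r x powr (1 / 4)) ^ 4 = r x"
      using rpos powr_powr[of "r x" "1/4" 4] by (simp flip: powr_numeral)
    then have "?s ^ 4 = r x" by (simp add: power_mult_distrib \<sigma>4)
    then have Q\<psi>: "Q (\<psi> x) = x \<bullet> i0" using Qz by (simp add: \<psi>_def Q_scaleR r_def)
    have \<psi>i: "\<psi> x \<bullet> i0 = ?s" by (simp add: \<psi>_def zi)
    show "\<psi> x \<in> W" using x s by (auto simp: W_def Q\<psi> \<psi>i W'_def)
    have "\<phi> (\<psi> x) = z x + (x \<bullet> i0 - 1) *\<^sub>R i0"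
      unfolding \<phi>_def Q\<psi> \<psi>i
      by (simp only: \<psi>_def scaleR_scaleR left_inverse[OF s(2)] scaleR_one)
    then show "\<phi> (\<psi> x) = x" by (simp add: z_def algebra_simps)
  qed
  have sm\<phi>: "smooth_on \<phi> W"
    unfolding \<phi>_def[abs_def] using oW
    by (intro smooth_on_add smooth_on_scaleR smooth_on_diff smooth_on_inverse smooth_on_inner_left
        smooth_on_Q smooth_on_const smooth_on_ident) (auto simp: W_def)
  have smr: "smooth_on r W'"
    unfolding r_def[abs_def] using oW'
    by (intro smooth_on_mult smooth_on_inverse smooth_on_inner_left smooth_on_Q smz smooth_on_ident)
      (auto simp: W'_def)
  have sm\<psi>: "smooth_on \<psi> W'"
    unfolding \<psi>_def[abs_def] using oW'
    by (intro smooth_on_mult smooth_on_scaleR smooth_on_powr smr smz smooth_on_const)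
      (auto simp: W'_def r_def zero_less_mult_iff)
  have "0 < \<sigma> * (A0 \<bullet> i0)" using i0(2) by (simp add: \<sigma>_def sgn_if mult_neg_neg)
  then have "A0 \<in> W" using A0 by (simp add: W_def)
  obtain a b where ab: "\<phi> A0 \<in> box a b" "box a b \<subseteq> W'"
    and dif: "diffeomorphism \<phi> {x \<in> W. \<phi> x \<in> box a b} (box a b)"
    using box_chart[OF oW oW' fwd bwd sm\<phi> sm\<psi> \<open>A0 \<in> W\<close>] by blast
  let ?U = "{x \<in> W. \<phi> x \<in> box a b}"
  have I: "Basis - (Basis - {i0}) = {i0}" using i0(1) by auto
  have "slice_chart (DIM('v) - 1) (G_leaves act \<omega> B) (G_tangent act) ?U \<phi> a b (Basis - {i0})"
    unfolding slice_chart_def I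
  proof (intro conjI ballI)
    show "card (Basis - {i0}) = DIM('v) - 1" using i0(1) by simp
    show "diffeomorphism \<phi> ?U (box a b)" by (rule dif)
    show "(\<exists>l\<in>G_leaves act \<omega> B. x \<in> l \<and> y \<in> l) = (\<forall>i\<in>{i0}. \<phi> x \<bullet> i = \<phi> y \<bullet> i)"
      if x: "x \<in> ?U" and y: "y \<in> ?U" for x y
    proof
      assume "\<exists>l\<in>G_leaves act \<omega> B. x \<in> l \<and> y \<in> l"
      then have "Q x = Q y" using Q_exp_orbit by (auto simp: G_leaves_eq)
      then show "\<forall>i\<in>{i0}. \<phi> x \<bullet> i = \<phi> y \<bullet> i" using x y \<phi>i by simp
    next
      assume "\<forall>i\<in>{i0}. \<phi> x \<bullet> i = \<phi> y \<bullet> i"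
      then have eq: "\<phi> y \<bullet> i0 = \<phi> x \<bullet> i0" by simp
      let ?Z = "{u \<in> box a b. \<forall>i\<in>{i0}. u \<bullet> i = \<phi> x \<bullet> i}"
      have "connected (\<psi> ` ?Z)"
      proof (rule connected_continuous_image)
        show "continuous_on ?Z \<psi>"
          by (rule continuous_on_subset[OF smooth_on_imp_continuous_on[OF sm\<psi>]]) (use ab(2) in auto)
        show "connected ?Z" by (rule convex_connected[OF convex_slice])
      qed
      moreover have "x \<in> \<psi> ` ?Z" "y \<in> \<psi> ` ?Z"
        using x y fwd eq by (auto intro!: image_eqI[of x \<psi> "\<phi> x"] image_eqI[of y \<psi> "\<phi> y"])
      moreover have "Q x \<noteq> 0" using x by (simp add: W_def)
      moreover have "Q u = Q x" if "u \<in> \<psi> ` ?Z" for u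
      proof -
        obtain p where p: "p \<in> ?Z" "u = \<psi> p" using \<open>u \<in> \<psi> ` ?Z\<close> by (elim imageE)
        then have "u \<in> W" "\<phi> u = p" using bwd[of p] ab(2) by auto
        then show ?thesis using \<phi>i[of u] \<phi>i[of x] p(1) x by simp
      qed
      ultimately have "y \<in> exp_orbit act x" by (rule same_orbit_if_connected_in_level_set)
      then show "\<exists>l\<in>G_leaves act \<omega> B. x \<in> l \<and> y \<in> l"
        using \<open>Q x \<noteq> 0\<close> exp_orbit_self by (auto simp: G_leaves_eq ssr_domain_def)
    qed
    show "G_tangent act A = {v. \<forall>i\<in>{i0}. frechet_derivative \<phi> (at A) v \<bullet> i = 0}" if A: "A \<in> ?U" for A
    proof -
      have QA: "Q A \<noteq> 0" and AW: "A \<in> W" using A by (auto simp: W_def)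
      have "((\<lambda>x. \<phi> x \<bullet> i0) has_derivative (\<lambda>v. frechet_derivative \<phi> (at A) v \<bullet> i0)) (at A)"
        by (rule bounded_linear.has_derivative[OF bounded_linear_inner_left
              smooth_on_has_derivative[OF sm\<phi> AW]])
      moreover have "((\<lambda>x. \<phi> x \<bullet> i0) has_derivative (\<lambda>v. 6 * \<omega> v (Psi A))) (at A)"
        by (rule has_derivative_transform_within_open[OF Q_has_derivative oW AW]) (simp add: \<phi>i)
      ultimately have "frechet_derivative \<phi> (at A) v \<bullet> i0 = 6 * \<omega> v (Psi A)" for v
        using has_derivative_unique by metis
      then show ?thesis by (simp add: G_tangent_def orbit_tangent[OF QA])
    qed
  qed auto
  moreover have "A0 \<in> ?U" "?U \<subseteq> ssr_domain act \<omega> B"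
    using \<open>A0 \<in> W\<close> ab(1) by (auto simp: W_def ssr_domain_def)
  ultimately show ?thesis by (intro exI conjI)
qed

lemma open_domain: "open (ssr_domain act \<omega> B)"
  unfolding ssr_domain_def by (intro open_Collect_neq continuous_intros continuous_on_Q)

lemma foliation_G: "foliation (ssr_domain act \<omega> B) (DIM('v) - 1) (G_leaves act \<omega> B) (G_tangent act)"
proof (rule foliation_if_slice_charts[OF open_domain partition_G_leaves])
  show "connected l" if "l \<in> G_leaves act \<omega> B" for l
    using that path_connected_exp_orbit[OF bilinear_act]
    by (auto simp: G_leaves_eq intro: path_connected_imp_connected)
  show "\<exists>U \<phi> a b I. A \<in> U \<and> U \<subseteq> ssr_domain act \<omega> B \<and>
      slice_chart (DIM('v) - 1) (G_leaves act \<omega> B) (G_tangent act) U \<phi> a b I"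
    if "A \<in> ssr_domain act \<omega> B" for A
    using that slice_chart_G by (simp add: ssr_domain_def)
qed


section \<open>The foliation by fibres\<close>

text \<open>The integral curve of \<open>\<Psi>\<close> through \<open>A\<close>, with the parameter \<open>t\<close> chosen as the ratio of the coefficients of
\<open>\<Psi> A\<close> and \<open>A\<close> instead of time: for \<open>Q A > 0\<close> and time \<open>s\<close> it is \<open>tanh (s \<surd>Q A) / \<surd>Q A\<close>. The curve
becomes algebraic in this parameter, and the factor puts the point on the conic \<open>a\<^sup>2 - b\<^sup>2 Q A = 1\<close>.\<close>

definition flow :: "real \<Rightarrow> 'v \<Rightarrow> 'v" where
  "flow t A = (1 - Q A * t\<^sup>2) powr - (1 / 2) *\<^sub>R (A + t *\<^sub>R Psi A)"

context
  fixes t A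
  assumes pos: "0 < 1 - Q A * t\<^sup>2"
begin

lemma flow_normalization:
  defines "c \<equiv> (1 - Q A * t\<^sup>2) powr - (1 / 2)"
  shows "c \<noteq> 0" "c\<^sup>2 - (c * t)\<^sup>2 * Q A = 1" "flow t A = c *\<^sub>R A + (c * t) *\<^sub>R Psi A"
proof -
  show "c \<noteq> 0" using pos by (simp add: c_def)
  have "c\<^sup>2 = inverse (1 - Q A * t\<^sup>2)"
    using pos powr_powr[of "1 - Q A * t\<^sup>2" "- (1 / 2)" 2]
    by (simp add: c_def powr_minus flip: powr_numeral)
  then have "c\<^sup>2 * (1 - Q A * t\<^sup>2) = 1" using pos by simp
  then show "c\<^sup>2 - (c * t)\<^sup>2 * Q A = 1" by (simp add: power_mult_distrib algebra_simps)
  show "flow t A = c *\<^sub>R A + (c * t) *\<^sub>R Psi A" by (simp add: flow_def c_def algebra_simps)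
qed

lemma mu_flow: "B (flow t A) (flow t A) = B A A"
  by (simp only: flow_normalization(2,3) mu_plane scaleR_one)

lemma Q_flow: "Q (flow t A) = Q A"
  by (simp only: flow_normalization(2,3) Q_plane one_power2 mult_1)

lemma Psi_flow:
  "Psi (flow t A) = (1 - Q A * t\<^sup>2) powr - (1 / 2) *\<^sub>R (Psi A + (t * Q A) *\<^sub>R A)"
  by (simp only: flow_normalization(2,3) Psi_plane scaleR_one) (simp add: algebra_simps)

lemma flow_flow: "flow (- t) (flow t A) = A"
proof -
  let ?c = "(1 - Q A * t\<^sup>2) powr - (1 / 2)"
  have "flow (- t) (flow t A) = ?c *\<^sub>R (flow t A - t *\<^sub>R Psi (flow t A))"
    by (simp add: flow_def[of "- t"] Q_flow)
  also have "\<dots> = (?c * ?c) *\<^sub>R (A + t *\<^sub>R Psi A - t *\<^sub>R (Psi A + (t * Q A) *\<^sub>R A))"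
    by (simp only: Psi_flow, simp add: flow_def algebra_simps)
  also have "\<dots> = (?c\<^sup>2 - (?c * t)\<^sup>2 * Q A) *\<^sub>R A"
    by (simp add: power2_eq_square algebra_simps)
  finally show ?thesis by (simp add: flow_normalization(2))
qed

end

lemma smooth_on_flow:
  assumes "open S" "smooth_on \<tau> S" "smooth_on f S" "\<And>x. x \<in> S \<Longrightarrow> 0 < 1 - Q (f x) * (\<tau> x)\<^sup>2"
  shows "smooth_on (\<lambda>x. flow (\<tau> x) (f x)) S"
  unfolding flow_def power2_eq_square using assms(4)
  by (intro smooth_on_scaleR smooth_on_powr smooth_on_diff smooth_on_mult smooth_on_add
      smooth_on_Q smooth_on_Psi smooth_on_const assms(1-3)) (simp_all add: power2_eq_square)

text \<open>The functional \<open>\<theta> u = \<omega> u A0\<close> vanishes at \<open>A0\<close> but not at \<open>\<Psi> A0\<close>, so its kernel is a section transverse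
to \<open>\<Psi>\<close>. The conic through \<open>A\<close> meets the section at \<open>Y A\<close> for the parameter \<open>- \<tau> A\<close>, where
\<open>\<tau> A = \<theta> A / \<theta> (\<Psi> A)\<close>. The chart records \<open>\<tau> A\<close> in a coordinate \<open>i1\<close> with \<open>\<theta> i1 \<noteq> 0\<close> and \<open>Y A\<close> in the
remaining ones, from which \<open>\<pi>\<close>, the projection to the section along \<open>i1\<close>, recovers it.\<close>

lemma slice_chart_F:
  assumes A0: "Q A0 \<noteq> 0"
  shows "\<exists>U \<phi> a b I. A0 \<in> U \<and> U \<subseteq> ssr_domain act \<omega> B \<and>
    slice_chart 1 (F_leaves act \<omega> B) (F_tangent B) U \<phi> a b I"
proof -
  define \<theta> where "\<theta> u = \<omega> u A0" for u
  have lin: "linear \<theta>" by (rule linearI) (simp_all add: \<theta>_def w_simps)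
  then have bl: "bounded_linear \<theta>" by (simp add: linear_conv_bounded_linear)
  note \<theta>_simps = linear_add[OF lin] linear_diff[OF lin] linear_scale[OF lin]
  have \<theta>0: "\<theta> A0 = 0" "\<theta> (Psi A0) \<noteq> 0"
    using A0 w_skew[of A0 "Psi A0"] by (auto simp: \<theta>_def Q_eq)
  have "\<exists>i\<in>Basis. \<theta> i \<noteq> 0"
  proof (rule ccontr)
    assume "\<not> ?thesis"
    then have "\<theta> = (\<lambda>x. 0)" by (intro linear_eq_stdbasis lin linear_zero) auto
    with \<theta>0(2) show False by simp
  qed
  then obtain i1 where i1: "i1 \<in> Basis" "\<theta> i1 \<noteq> 0" by blast
  have ii: "i1 \<bullet> i1 = 1" using i1(1) by simp
  define \<pi> where "\<pi> u = u - (\<theta> u / \<theta> i1) *\<^sub>R i1" for u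
  have lin\<pi>: "linear \<pi>"
    by (rule linearI) (simp_all add: \<pi>_def \<theta>_simps algebra_simps add_divide_distrib)
  then have bl\<pi>: "bounded_linear \<pi>" by (simp add: linear_conv_bounded_linear)
  have \<pi>i: "\<pi> i1 = 0" using i1(2) by (simp add: \<pi>_def)
  have \<theta>\<pi>: "\<theta> (\<pi> u) = 0" for u using i1(2) by (simp add: \<pi>_def \<theta>_simps)
  have \<pi>id: "\<pi> u = u" if "\<theta> u = 0" for u using that by (simp add: \<pi>_def)
  have \<pi>shift: "\<pi> (u + s *\<^sub>R i1) = \<pi> u" for u s
    by (simp add: linear_add[OF lin\<pi>] linear_scale[OF lin\<pi>] \<pi>i)
  have \<pi>cong: "\<pi> u = \<pi> v" if "\<forall>i\<in>Basis - {i1}. u \<bullet> i = v \<bullet> i" for u v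
  proof -
    have "u = v + ((u - v) \<bullet> i1) *\<^sub>R i1"
    proof (rule euclidean_eqI)
      fix j :: 'v assume "j \<in> Basis"
      then show "u \<bullet> j = (v + ((u - v) \<bullet> i1) *\<^sub>R i1) \<bullet> j"
        using that i1(1) by (cases "j = i1") (auto simp: inner_add_left inner_diff_left inner_Basis)
    qed
    then show ?thesis using \<pi>shift by metis
  qed
  define \<tau> where "\<tau> A = \<theta> A * inverse (\<theta> (Psi A))" for A
  define Y where "Y A = flow (- \<tau> A) A" for A
  define \<phi> where "\<phi> A = Y A + (\<tau> A - Y A \<bullet> i1) *\<^sub>R i1" for A
  define \<psi> where "\<psi> x = flow (x \<bullet> i1) (\<pi> x)" for x
  define W0 where "W0 = {A. Q A \<noteq> 0 \<and> \<theta> (Psi A) \<noteq> 0}"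
  define W where "W = {A \<in> W0. 0 < 1 - Q A * (\<tau> A)\<^sup>2}"
  define W' where "W' = {x. \<pi> x \<in> W0 \<and> 0 < 1 - Q (\<pi> x) * (x \<bullet> i1)\<^sup>2}"
  have smPsi: "smooth_on Psi S" if "open S" for S
    using smooth_on_Psi[OF that smooth_on_ident[OF that]] by simp
  have smQ: "smooth_on Q S" if "open S" for S
    using smooth_on_Q[OF that smooth_on_ident[OF that]] by simp
  have cPsi: "continuous_on S (\<lambda>A. \<theta> (Psi A))" for S
    by (rule continuous_on_subset[OF bounded_linear.continuous_on[OF bl
        smooth_on_imp_continuous_on[OF smPsi[OF open_UNIV]]]]) simp
  have oW0: "open W0"
    unfolding W0_def by (intro open_Collect_conj open_Collect_neq continuous_intros continuous_on_Q cPsi)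
  have sm\<tau>: "smooth_on \<tau> W0"
    unfolding \<tau>_def[abs_def] using oW0
    by (intro smooth_on_mult smooth_on_inverse smooth_on_linear[OF bl] smooth_on_ident smPsi)
      (auto simp: W0_def)
  have oW: "open W"
  proof -
    have "continuous_on W0 (\<lambda>A. 1 - Q A * (\<tau> A)\<^sup>2)"
      by (intro continuous_intros continuous_on_Q smooth_on_imp_continuous_on[OF sm\<tau>])
    from continuous_open_preimage[OF this oW0 open_greaterThan[of 0]]
    show ?thesis by (simp add: W_def Int_def vimage_def)
  qed
  have oW': "open W'"
  proof -
    have c\<pi>: "continuous_on UNIV \<pi>" by (rule linear_continuous_on[OF bl\<pi>])
    have "open {x. \<pi> x \<in> W0}"
      using open_vimage[OF oW0 c\<pi>] by (simp add: vimage_def)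
    moreover have "open {x. 0 < 1 - Q (\<pi> x) * (x \<bullet> i1)\<^sup>2}"
      by (intro open_Collect_less continuous_intros
          continuous_on_compose2[OF continuous_on_Q c\<pi>]) auto
    ultimately show ?thesis unfolding W'_def by (rule open_Collect_conj)
  qed
  have posm: "0 < 1 - Q A * (- t)\<^sup>2" if "0 < 1 - Q A * t\<^sup>2" for A t using that by simp
  have \<theta>Y: "\<theta> (Y A) = 0" if "A \<in> W" for A
    using that by (simp add: Y_def flow_def \<theta>_simps \<tau>_def W_def W0_def)
  have \<pi>\<phi>: "\<pi> (\<phi> A) = Y A" if "A \<in> W" for A
    using \<pi>id[OF \<theta>Y[OF that]] by (simp add: \<phi>_def \<pi>shift)
  have \<phi>i: "\<phi> A \<bullet> i1 = \<tau> A" for A by (simp add: \<phi>_def inner_add_left ii)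
  have fwd: "\<phi> A \<in> W' \<and> \<psi> (\<phi> A) = A" if A: "A \<in> W" for A
  proof
    have pos: "0 < 1 - Q A * (- \<tau> A)\<^sup>2" using A by (simp add: W_def)
    have QY: "Q (Y A) = Q A" unfolding Y_def by (rule Q_flow[OF pos])
    have "\<theta> (Psi (Y A)) = (1 - Q A * (\<tau> A)\<^sup>2) powr - (1 / 2) * (1 - Q A * (\<tau> A)\<^sup>2) * \<theta> (Psi A)"
      using A unfolding Y_def Psi_flow[OF pos]
      by (simp add: \<theta>_simps \<tau>_def W_def W0_def power2_eq_square field_simps)
    then have "\<theta> (Psi (Y A)) \<noteq> 0" using A by (simp add: W_def W0_def)
    then show "\<phi> A \<in> W'" using A by (simp add: W'_def \<pi>\<phi> \<phi>i QY W_def W0_def)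
    show "\<psi> (\<phi> A) = A"
      using flow_flow[OF pos] by (simp add: \<psi>_def \<pi>\<phi>[OF A] \<phi>i Y_def)
  qed
  have bwd: "\<psi> x \<in> W \<and> \<phi> (\<psi> x) = x" and mu\<psi>: "B (\<psi> x) (\<psi> x) = B (\<pi> x) (\<pi> x)"
    if x: "x \<in> W'" for x
  proof -
    have pos: "0 < 1 - Q (\<pi> x) * (x \<bullet> i1)\<^sup>2" using x by (simp add: W'_def)
    then have c: "(1 - Q (\<pi> x) * (x \<bullet> i1)\<^sup>2) powr - (1 / 2) \<noteq> 0" by simp
    have nz: "Q (\<pi> x) \<noteq> 0" "\<theta> (Psi (\<pi> x)) \<noteq> 0" using x by (auto simp: W'_def W0_def)
    have Q\<psi>: "Q (\<psi> x) = Q (\<pi> x)" unfolding \<psi>_def by (rule Q_flow[OF pos])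
    have l1: "\<theta> (\<psi> x) = (1 - Q (\<pi> x) * (x \<bullet> i1)\<^sup>2) powr - (1 / 2) * ((x \<bullet> i1) * \<theta> (Psi (\<pi> x)))"
      unfolding \<psi>_def by (simp add: flow_def \<theta>_simps \<theta>\<pi>)
    have l2: "\<theta> (Psi (\<psi> x)) = (1 - Q (\<pi> x) * (x \<bullet> i1)\<^sup>2) powr - (1 / 2) * \<theta> (Psi (\<pi> x))"
      unfolding \<psi>_def by (simp add: Psi_flow[OF pos] \<theta>_simps \<theta>\<pi>)
    have \<tau>\<psi>: "\<tau> (\<psi> x) = x \<bullet> i1"
      unfolding \<tau>_def l1 l2 using c nz by (simp add: divide_simps)
    have W: "\<psi> x \<in> W"
      using nz c pos by (simp add: W_def W0_def Q\<psi> \<tau>\<psi> l2)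
    have "Y (\<psi> x) = \<pi> x"
      unfolding Y_def \<tau>\<psi> unfolding \<psi>_def by (rule flow_flow[OF pos])
    then have "\<phi> (\<psi> x) = x"
      by (simp add: \<phi>_def \<tau>\<psi>) (simp add: \<pi>_def inner_diff_left ii algebra_simps)
    with W show "\<psi> x \<in> W \<and> \<phi> (\<psi> x) = x" by blast
    show "B (\<psi> x) (\<psi> x) = B (\<pi> x) (\<pi> x)" unfolding \<psi>_def by (rule mu_flow[OF pos])
  qed
  have sm\<tau>W: "smooth_on \<tau> W" by (rule smooth_on_subset[OF sm\<tau>]) (auto simp: W_def)
  have smY: "smooth_on Y W"
    unfolding Y_def[abs_def] using oW
    by (intro smooth_on_flow smooth_on_linear[OF bounded_linear_minus[OF bounded_linear_ident]]
        sm\<tau>W smooth_on_ident) (auto simp: W_def)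
  have sm\<phi>: "smooth_on \<phi> W"
    unfolding \<phi>_def[abs_def] using oW
    by (intro smooth_on_add smooth_on_scaleR smooth_on_diff smooth_on_inner_left smooth_on_const smY sm\<tau>W)
  have sm\<psi>: "smooth_on \<psi> W'"
    unfolding \<psi>_def[abs_def] using oW'
    by (intro smooth_on_flow smooth_on_linear[OF bl\<pi>] smooth_on_inner_left smooth_on_ident)
      (auto simp: W'_def)
  have "A0 \<in> W" using A0 \<theta>0 by (simp add: W_def W0_def \<tau>_def)
  obtain a b where ab: "\<phi> A0 \<in> box a b" "box a b \<subseteq> W'"
    and dif: "diffeomorphism \<phi> {x \<in> W. \<phi> x \<in> box a b} (box a b)"
    using box_chart[OF oW oW' fwd bwd sm\<phi> sm\<psi> \<open>A0 \<in> W\<close>] by blast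
  let ?U = "{x \<in> W. \<phi> x \<in> box a b}"
  \<comment> \<open>\<open>\<mu>\<close> separates the points of the section; the midpoint stays in the box by convexity.\<close>
  have mu_inj: "\<pi> u = \<pi> v"
    if u: "u \<in> box a b" and v: "v \<in> box a b" and mu: "B (\<pi> u) (\<pi> u) = B (\<pi> v) (\<pi> v)" for u v
  proof -
    let ?m = "(1 / 2) *\<^sub>R u + (1 / 2) *\<^sub>R v"
    have "?m \<in> box a b" by (rule convexD[OF convex_box(2) u v]) auto
    then have nz: "Q (\<pi> ?m) \<noteq> 0" "\<theta> (Psi (\<pi> ?m)) \<noteq> 0" using ab(2) by (auto simp: W'_def W0_def)
    have \<pi>m: "\<pi> ?m = (1 / 2) *\<^sub>R \<pi> u + (1 / 2) *\<^sub>R \<pi> v"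
      by (simp only: linear_add[OF lin\<pi>] linear_scale[OF lin\<pi>])
    have "B (\<pi> ?m) (\<pi> u - \<pi> v) = 0"
      unfolding \<pi>m using mu by (simp add: B_simps B_commute[of "\<pi> v" "\<pi> u"])
    then obtain c where c: "\<pi> u - \<pi> v = c *\<^sub>R Psi (\<pi> ?m)" using kernel_dmu[OF nz(1)] by blast
    have "c * \<theta> (Psi (\<pi> ?m)) = \<theta> (\<pi> u - \<pi> v)" by (simp only: c linear_scale[OF lin] real_scaleR_def)
    also have "\<dots> = 0" by (simp only: linear_diff[OF lin] \<theta>\<pi>)
    finally have "c = 0" using nz(2) by simp
    with c show ?thesis by simp
  qed
  have mu\<phi>: "B A A = B (\<pi> (\<phi> A)) (\<pi> (\<phi> A))" if "A \<in> W" for A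
    using mu\<psi>[of "\<phi> A"] fwd[OF that] by simp
  have I: "{i1} \<subseteq> Basis" using i1(1) by simp
  have "slice_chart 1 (F_leaves act \<omega> B) (F_tangent B) ?U \<phi> a b {i1}"
    unfolding slice_chart_def
  proof (intro conjI ballI I dif)
    show "(\<exists>l\<in>F_leaves act \<omega> B. x \<in> l \<and> y \<in> l) = (\<forall>i\<in>Basis - {i1}. \<phi> x \<bullet> i = \<phi> y \<bullet> i)"
      if x: "x \<in> ?U" and y: "y \<in> ?U" for x y
    proof
      assume "\<exists>l\<in>F_leaves act \<omega> B. x \<in> l \<and> y \<in> l"
      then have "B x x = B y y"
        unfolding F_leaves_def ssr_mu_def by (auto dest!: in_components_subset)
      then have "\<pi> (\<phi> x) = \<pi> (\<phi> y)" using x y mu\<phi> by (intro mu_inj) auto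
      then have "Y x = Y y" using x y \<pi>\<phi> by simp
      then show "\<forall>i\<in>Basis - {i1}. \<phi> x \<bullet> i = \<phi> y \<bullet> i"
        using i1(1) by (auto simp: \<phi>_def inner_add_left inner_Basis)
    next
      assume eq: "\<forall>i\<in>Basis - {i1}. \<phi> x \<bullet> i = \<phi> y \<bullet> i"
      let ?Z = "{u \<in> box a b. \<forall>i\<in>Basis - {i1}. u \<bullet> i = \<phi> x \<bullet> i}"
      let ?Fib = "{A \<in> ssr_domain act \<omega> B. ssr_mu B A = B x x}"
      have "connected (\<psi> ` ?Z)"
      proof (rule connected_continuous_image)
        show "continuous_on ?Z \<psi>"
          by (rule continuous_on_subset[OF smooth_on_imp_continuous_on[OF sm\<psi>]]) (use ab(2) in auto)
        show "connected ?Z" by (rule convex_connected[OF convex_slice])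
      qed
      moreover have xy: "x \<in> \<psi> ` ?Z" "y \<in> \<psi> ` ?Z"
        using x y fwd eq by (auto intro!: image_eqI[of x \<psi> "\<phi> x"] image_eqI[of y \<psi> "\<phi> y"])
      moreover have sub_fib: "\<psi> ` ?Z \<subseteq> ?Fib"
      proof
        fix A assume "A \<in> \<psi> ` ?Z"
        then obtain u where u: "u \<in> ?Z" "A = \<psi> u" by blast
        then have uW: "u \<in> W'" using ab(2) by auto
        have "\<pi> u = \<pi> (\<phi> x)" using u by (intro \<pi>cong) auto
        then have "B A A = B x x" using mu\<psi>[OF uW] mu\<phi>[of x] x u(2) by simp
        moreover have "Q A \<noteq> 0" using bwd[OF uW] u(2) by (auto simp: W_def W0_def)
        ultimately show "A \<in> ?Fib" by (simp add: ssr_domain_def ssr_mu_def)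
      qed
      moreover have "?Fib \<noteq> {}" using subsetD[OF sub_fib xy(1)] by (rule ex_in_conv[THEN iffD1, OF exI])
      ultimately have "\<exists>l. l \<in> components ?Fib \<and> \<psi> ` ?Z \<subseteq> l"
        by (intro exists_component_superset)
      then obtain l where l: "l \<in> components ?Fib" and sub: "\<psi> ` ?Z \<subseteq> l" by (elim exE conjE)
      have "l \<in> F_leaves act \<omega> B" unfolding F_leaves_def using l by (rule UN_I[OF UNIV_I])
      then show "\<exists>l\<in>F_leaves act \<omega> B. x \<in> l \<and> y \<in> l"
        using subsetD[OF sub xy(1)] subsetD[OF sub xy(2)] by (intro bexI conjI)
    qed
    show "F_tangent B A = {v. \<forall>i\<in>Basis - {i1}. frechet_derivative \<phi> (at A) v \<bullet> i = 0}"
      if A: "A \<in> ?U" for A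
    proof -
      have AW: "A \<in> W" and QA: "Q A \<noteq> 0" and \<phi>W': "\<phi> A \<in> W'"
        using A fwd by (auto simp: W_def W0_def)
      let ?D = "frechet_derivative \<phi> (at A)" and ?E = "frechet_derivative \<psi> (at (\<phi> A))"
      have D: "(\<phi> has_derivative ?D) (at A)" by (rule smooth_on_has_derivative[OF sm\<phi> AW])
      have E: "(\<psi> has_derivative ?E) (at (\<phi> A))" by (rule smooth_on_has_derivative[OF sm\<psi> \<phi>W'])
      have ED: "?E (?D v) = v" for v
        by (rule derivative_of_local_inverse[OF oW AW _ D E]) (use fwd in blast)
      have DE: "?D (?E v) = v" for v
        by (rule derivative_of_local_inverse[OF oW' \<phi>W' _ E]) (use bwd fwd[OF AW] D in auto)
      have linE: "linear ?E" and linD: "linear ?D"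
        using D E by (auto intro: has_derivative_linear)
      \<comment> \<open>\<open>\<mu>\<close> is constant on slices, so moving along \<open>i1\<close> is a direction in the kernel of its derivative.\<close>
      have "B A (?E i1) = 0"
      proof -
        have d1: "((\<lambda>x. actB (\<psi> x) (\<psi> x)) has_derivative
            (\<lambda>v. actB (\<psi> (\<phi> A)) (?E v) + actB (?E v) (\<psi> (\<phi> A)))) (at (\<phi> A))"
          by (rule bounded_bilinear.FDERIV[OF bounded_bilinear_actB E E])
        have "(\<pi> has_derivative \<pi>) (at (\<phi> A))" by (rule bounded_linear_imp_has_derivative[OF bl\<pi>])
        then have d2: "((\<lambda>x. actB (\<pi> x) (\<pi> x)) has_derivative
            (\<lambda>v. actB (\<pi> (\<phi> A)) (\<pi> v) + actB (\<pi> v) (\<pi> (\<phi> A)))) (at (\<phi> A))"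
          by (intro bounded_bilinear.FDERIV[OF bounded_bilinear_actB])
        have "((\<lambda>x. actB (\<psi> x) (\<psi> x)) has_derivative
            (\<lambda>v. actB (\<pi> (\<phi> A)) (\<pi> v) + actB (\<pi> v) (\<pi> (\<phi> A)))) (at (\<phi> A))"
          by (rule has_derivative_transform_within_open[OF d2 oW' \<phi>W']) (simp add: actB_def mu\<psi>)
        from has_derivative_unique[OF d1 this]
        have "actB (\<psi> (\<phi> A)) (?E i1) + actB (?E i1) (\<psi> (\<phi> A)) =
            actB (\<pi> (\<phi> A)) (\<pi> i1) + actB (\<pi> i1) (\<pi> (\<phi> A))" by (rule fun_cong)
        then have "actB A (?E i1) + actB (?E i1) A = 0"
          using fwd[OF AW] bounded_bilinear.zero_left[OF bounded_bilinear_actB]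
            bounded_bilinear.zero_right[OF bounded_bilinear_actB] by (simp add: \<pi>i)
        moreover have "actB (?E i1) A = actB A (?E i1)" by (simp add: actB_def B_commute[of A])
        ultimately have "2 *\<^sub>R actB A (?E i1) = 0" by (simp add: scaleR_2)
        then have "actB A (?E i1) = 0" by simp
        then have "act (B A (?E i1)) w = 0" for w
          using actB_apply[of A "?E i1" w] by simp
        then show ?thesis by (rule faithful)
      qed
      then obtain c where c: "?E i1 = c *\<^sub>R Psi A" using kernel_dmu[OF QA] by blast
      have "c \<noteq> 0"
      proof
        assume "c = 0"
        then have "?D (?E i1) = 0" using linear_0[OF linD] by (simp add: c)
        then show False using DE i1(1) by auto
      qed
      have "B A v = 0 \<longleftrightarrow> (\<forall>i\<in>Basis - {i1}. ?D v \<bullet> i = 0)" for v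
      proof
        assume "B A v = 0"
        then obtain c' where "v = c' *\<^sub>R Psi A" using kernel_dmu[OF QA] by blast
        then have "v = (c' / c) *\<^sub>R ?E i1" using \<open>c \<noteq> 0\<close> by (simp add: c)
        then have "?D v = (c' / c) *\<^sub>R i1" using linear_scale[OF linD] DE by metis
        then show "\<forall>i\<in>Basis - {i1}. ?D v \<bullet> i = 0" using i1(1) by (auto simp: inner_Basis)
      next
        assume *: "\<forall>i\<in>Basis - {i1}. ?D v \<bullet> i = 0"
        have "?D v = (?D v \<bullet> i1) *\<^sub>R i1"
          by (rule euclidean_eqI) (use * i1(1) in \<open>auto simp: inner_Basis\<close>)
        then have "v = (?D v \<bullet> i1) *\<^sub>R ?E i1" using ED linear_scale[OF linE] by metis
        then have "v = (?D v \<bullet> i1 * c) *\<^sub>R Psi A" by (simp add: c)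
        then show "B A v = 0" using kernel_dmu[OF QA] by blast
      qed
      then show ?thesis by (simp add: F_tangent_def ssr_dmu_def)
    qed
  qed simp
  moreover have "A0 \<in> ?U" "?U \<subseteq> ssr_domain act \<omega> B"
    using \<open>A0 \<in> W\<close> ab(1) by (auto simp: W_def W0_def ssr_domain_def)
  ultimately show ?thesis by (intro exI conjI)
qed

lemma partition_F_leaves: "partition_on (ssr_domain act \<omega> B) (F_leaves act \<omega> B)"
proof (rule partition_onI)
  show "\<Union> (F_leaves act \<omega> B) = ssr_domain act \<omega> B"
  proof -
    have "\<Union> (F_leaves act \<omega> B) =
        (\<Union>m. \<Union> (components {A \<in> ssr_domain act \<omega> B. ssr_mu B A = m}))"
      unfolding F_leaves_def by blast
    then show ?thesis by auto
  qed
  show "disjnt p q" if pq: "p \<in> F_leaves act \<omega> B" "q \<in> F_leaves act \<omega> B" "p \<noteq> q" for p q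
  proof -
    obtain m n where mn: "p \<in> components {A \<in> ssr_domain act \<omega> B. ssr_mu B A = m}"
      "q \<in> components {A \<in> ssr_domain act \<omega> B. ssr_mu B A = n}"
      using pq by (auto simp: F_leaves_def)
    show ?thesis
    proof (cases "m = n")
      case True
      then show ?thesis
        using components_nonoverlap[OF mn(1)] mn(2) pq(3) by (simp add: disjnt_def)
    next
      case False
      then show ?thesis
        using in_components_subset[OF mn(1)] in_components_subset[OF mn(2)] by (auto simp: disjnt_iff)
    qed
  qed
  show "{} \<notin> F_leaves act \<omega> B" by (auto simp: F_leaves_def dest: in_components_nonempty)
qed

lemma foliation_F: "foliation (ssr_domain act \<omega> B) 1 (F_leaves act \<omega> B) (F_tangent B)"
proof (rule foliation_if_slice_charts[OF open_domain partition_F_leaves])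
  show "connected l" if "l \<in> F_leaves act \<omega> B" for l
    using that by (auto simp: F_leaves_def intro: in_components_connected)
  show "\<exists>U \<phi> a b I. A \<in> U \<and> U \<subseteq> ssr_domain act \<omega> B \<and>
      slice_chart 1 (F_leaves act \<omega> B) (F_tangent B) U \<phi> a b I"
    if "A \<in> ssr_domain act \<omega> B" for A
    using that slice_chart_F by (simp add: ssr_domain_def)
qed

lemma symplectic_manifold_domain: "symplectic_manifold (ssr_domain act \<omega> B) (\<lambda>_. \<omega>)"
  using ssr by (simp add: symplectic_manifold_def open_domain smooth_on_const special_symplectic_rep_def)

end

theorem corollary3p7:
  fixes br :: "'m::real_vector \<Rightarrow> 'm \<Rightarrow> 'm"
    and act :: "'m \<Rightarrow> 'v::euclidean_space \<Rightarrow> 'v"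
    and \<omega> :: "'v \<Rightarrow> 'v \<Rightarrow> real"
    and B :: "'v \<Rightarrow> 'v \<Rightarrow> 'm"
  assumes "special_symplectic_rep br act \<omega> B"
    and "\<exists>A. ssr_Q act \<omega> B A \<noteq> 0"
  shows "nc_integrable_system_1 (ssr_domain act \<omega> B) (\<lambda>_. \<omega>)
           (F_leaves act \<omega> B) (F_tangent B)
           (G_leaves act \<omega> B) (G_tangent act)"
proof -
  interpret special_symplectic br act \<omega> B by standard (rule assms(1))
  have F: "F_tangent B A = {v. \<exists>c. v = c *\<^sub>R Psi A}" and G: "G_tangent act A = {v. \<omega> v (Psi A) = 0}"
    if "A \<in> ssr_domain act \<omega> B" for A
    using that kernel_dmu orbit_tangent
    by (simp_all add: F_tangent_def ssr_dmu_def G_tangent_def ssr_domain_def)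
  have "F_tangent B A \<subseteq> G_tangent act A" if "A \<in> ssr_domain act \<omega> B" for A
    unfolding F[OF that] G[OF that] by (auto simp: w_simps)
  moreover have "\<omega> u v = 0"
    if "A \<in> ssr_domain act \<omega> B" "u \<in> F_tangent B A" "v \<in> G_tangent act A" for A u v
    using that(2,3) w_skew[of u v] unfolding F[OF that(1)] G[OF that(1)] by (auto simp: w_simps)
  ultimately show ?thesis
    unfolding nc_integrable_system_1_def
    using symplectic_manifold_domain foliation_F foliation_G by blast
qed

end
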